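(* Let $G$ be a connected (claw, even-hole)-free graph with $n$ vertices. Then three cops have a strategy that captures the robber on $G$ within at most $n$ rounds.
   Context: A claw is $K_{1,3}$; a hole is an induced cycle of length at least $4$; an even hole is a hole of even length; (claw, even-hole)-free means no induced claw and no even hole. Game of cops and robber on a connected graph: in the first round the cops choose their starting vertices, then the robber chooses his; afterwards, in each round, first every cop either stays or moves to an adjacent vertex, then the robber either stays or moves to an adjacent vertex. The robber is captured when some cop occupies his vertex. *)

theory Defs
  imports "Graph_Theory.Graph_Theory"
begin

text \<open>
  Finite simple graphs are the locale \<open>graph\<close> of the library: finite symmetric digraphs without
  loops and parallel arcs. An undirected edge is a pair of opposite arcs, so \<open>(u, v) \<in> arcs_ends G\<close>
  is adjacency.
\<close>

definition claw_free :: "('a, 'b) pre_digraph \<Rightarrow> bool" where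
  "claw_free G \<longleftrightarrow> \<not> (\<exists>H. induced_subgraph H G \<and> complete_bipartite_digraph 1 3 H)"

text \<open>The undirected cycle \<open>C\<^sub>k\<close>. The library predicate \<open>pre_digraph.cycle\<close> is not used because it
  counts the closed walk \<open>a, b, a\<close> along an undirected edge as a cycle.\<close>

definition cycle_graph :: "nat \<Rightarrow> ('a, 'b) pre_digraph \<Rightarrow> bool" where
  "cycle_graph k H \<longleftrightarrow> graph H \<and> 3 \<le> k \<and>
     (\<exists>c. bij_betw c {..<k} (verts H) \<and>
          arcs_ends H = (\<Union>i<k. {(c i, c (Suc i mod k)), (c (Suc i mod k), c i)}))"

definition hole :: "nat \<Rightarrow> ('a, 'b) pre_digraph \<Rightarrow> ('a, 'b) pre_digraph \<Rightarrow> bool" where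
  "hole k H G \<longleftrightarrow> 4 \<le> k \<and> induced_subgraph H G \<and> cycle_graph k H"

definition even_hole_free :: "('a, 'b) pre_digraph \<Rightarrow> bool" where
  "even_hole_free G \<longleftrightarrow> \<not> (\<exists>k H. even k \<and> hole k H G)"

definition stay_or_move :: "('a, 'b) pre_digraph \<Rightarrow> 'a \<Rightarrow> 'a \<Rightarrow> bool" where
  "stay_or_move G u v \<longleftrightarrow> u \<in> verts G \<and> (v = u \<or> (u, v) \<in> arcs_ends G)"

text \<open>
  Rounds are numbered from \<open>1\<close>, the choice of the starting vertices being round \<open>1\<close>, and \<open>r t\<close> is
  the robber's vertex at the end of round \<open>t + 1\<close>. Plays are formally continued for ever, also
  after a capture. Nothing is lost, since both sides can always stay where they are.
\<close>

definition robber_play :: "('a, 'b) pre_digraph \<Rightarrow> (nat \<Rightarrow> 'a) \<Rightarrow> bool" where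
  "robber_play G r \<longleftrightarrow> r 0 \<in> verts G \<and> (\<forall>t. stay_or_move G (r t) (r (Suc t)))"

text \<open>
  A strategy gives, for the list of the robber's vertices in the rounds played so far, the vertex
  that cop \<open>i\<close> chooses in the next round. The earlier vertices of the cops need not be passed to the
  strategy because they are determined by it and this list.
\<close>

type_synonym 'a strategy = "'a list \<Rightarrow> nat \<Rightarrow> 'a"

text \<open>The vertex of cop \<open>i\<close> in round \<open>t + 1\<close>: it depends only on \<open>r 0, \<dots>, r (t - 1)\<close>.\<close>

definition cop_pos :: "'a strategy \<Rightarrow> (nat \<Rightarrow> 'a) \<Rightarrow> nat \<Rightarrow> nat \<Rightarrow> 'a" where
  "cop_pos \<sigma> r t i = \<sigma> (map r [0..<t]) i"

definition cop_strategy :: "('a, 'b) pre_digraph \<Rightarrow> nat \<Rightarrow> 'a strategy \<Rightarrow> bool" where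
  "cop_strategy G k \<sigma> \<longleftrightarrow>
     (\<forall>i<k. \<sigma> [] i \<in> verts G) \<and>
     (\<forall>r. robber_play G r \<longrightarrow>
        (\<forall>t. \<forall>i<k. stay_or_move G (cop_pos \<sigma> r t i) (cop_pos \<sigma> r (Suc t) i)))"

text \<open>Capture in round \<open>t + 1\<close> happens either by the robber's choice \<open>r t\<close> or, if \<open>t > 0\<close>, already
  by the preceding move of the cops, when the robber is still on \<open>r (t - 1)\<close>.\<close>

definition captured_in_round_Suc :: "nat \<Rightarrow> 'a strategy \<Rightarrow> (nat \<Rightarrow> 'a) \<Rightarrow> nat \<Rightarrow> bool" where
  "captured_in_round_Suc k \<sigma> r t \<longleftrightarrow>
     (\<exists>i<k. (0 < t \<and> cop_pos \<sigma> r t i = r (t - 1)) \<or> cop_pos \<sigma> r t i = r t)"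

definition cops_capture_within :: "('a, 'b) pre_digraph \<Rightarrow> nat \<Rightarrow> nat \<Rightarrow> bool" where
  "cops_capture_within G k n \<longleftrightarrow>
     (\<exists>\<sigma>. cop_strategy G k \<sigma> \<and> (\<forall>r. robber_play G r \<longrightarrow> (\<exists>t<n. captured_in_round_Suc k \<sigma> r t)))"

end

theory Submission
  imports Defs
begin

text \<open>
  The cops move outwards from a start vertex. Let \<open>C\<close> be the component in which the robber is confined
  and \<open>D\<close> the connected part already left behind; every neighbour of \<open>C\<close> is adjacent to \<open>D\<close>. The key
  fact is that two of these neighbours suffice to dominate everything in \<open>C\<close> that is adjacent to any of
  them. If three neighbours with private vertices in \<open>C\<close> were needed, then joining them pairwise by
  induced paths through \<open>C\<close> (and through \<open>D\<close>) yields holes. In a claw-free graph these paths can be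
  chosen to meet in a triangle, which makes the sum of their lengths odd, and this contradicts the
  oddness of all holes.

  Hence two cops can hold the robber and shrink \<open>C\<close> in every round; the third one is needed only
  at the start vertex, whose neighbourhood need not be a clique. When \<open>C\<close> turns out to be attached to
  one of the two cops only, the other one walks to him along an induced path through the old
  \<open>C\<close>. The vertices of this path are no longer accessible to the robber, so they pay for the rounds of
  that walk, and the total number of rounds stays at most \<open>n\<close>.
\<close>

section \<open>Induced paths and connected sets\<close>

locale simple_graph =
  fixes E :: "'a \<Rightarrow> 'a \<Rightarrow> bool"
  assumes sym: "E u v \<Longrightarrow> E v u"
    and irrefl: "\<not> E v v"
begin

lemma adj_commute: "E u v \<longleftrightarrow> E v u"
  using sym by blast

primrec ipath :: "'a list \<Rightarrow> bool" where
  "ipath [] = True"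
| "ipath (x # zs) = (x \<notin> set zs \<and> ipath zs \<and> (\<forall>z\<in>set zs. E x z \<longleftrightarrow> z = hd zs))"

lemma ipath_distinct: "ipath zs \<Longrightarrow> distinct zs"
  by (induction zs) auto

lemma ipath_append:
  "ipath (xs @ ys) \<longleftrightarrow> ipath xs \<and> ipath ys \<and> set xs \<inter> set ys = {} \<and>
     (\<forall>x\<in>set xs. \<forall>y\<in>set ys. E x y \<longleftrightarrow> x = last xs \<and> y = hd ys)"
proof (induction xs)
  case (Cons x xs)
  show ?case
  proof (cases "xs = []")
    case False
    then have "last xs \<in> set xs" "hd xs \<in> set xs" by auto
    moreover have "hd xs \<notin> set ys" if "set xs \<inter> set ys = {}"
      using \<open>hd xs \<in> set xs\<close> that by blast
    ultimately show ?thesis using Cons False by (auto simp: hd_append)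
  qed auto
qed simp

lemma ipath_rev: "ipath (rev zs) \<longleftrightarrow> ipath zs"
proof (induction zs)
  case (Cons x zs)
  then show ?case using sym by (auto simp: ipath_append last_rev)
qed simp

lemma ipath_nth_adj:
  assumes "ipath zs" "i < length zs" "j < length zs"
  shows "E (zs ! i) (zs ! j) \<longleftrightarrow> j = Suc i \<or> i = Suc j"
  using assms
proof (induction zs arbitrary: i j)
  case (Cons x zs)
  have hd: "E x (zs ! l) \<longleftrightarrow> l = 0" if "l < length zs" for l
    using Cons.prems(1) that ipath_distinct[of zs]
    by (cases zs) (auto simp: nth_Cons')
  show ?case
  proof (cases i)
    case 0
    then show ?thesis using Cons.prems hd irrefl by (cases j) auto
  next
    case (Suc i')
    have "E (zs ! l) x \<longleftrightarrow> l = 0" if "l < length zs" for l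
      using hd[OF that] sym by blast
    then show ?thesis using Cons Suc hd by (cases j) auto
  qed
qed simp

section \<open>Connected sets and induced paths through them\<close>

definition conn :: "'a set \<Rightarrow> bool" where
  "conn C \<longleftrightarrow> (\<forall>u\<in>C. \<forall>v\<in>C. (\<lambda>a b. a \<in> C \<and> b \<in> C \<and> E a b)\<^sup>*\<^sup>* u v)"

lemma conn_crossing:
  assumes "conn C" "u \<in> C" "v \<in> C" "u \<in> S" "v \<notin> S"
  obtains a b where "a \<in> C" "b \<in> C" "E a b" "a \<in> S" "b \<notin> S"
proof -
  have "(\<lambda>a b. a \<in> C \<and> b \<in> C \<and> E a b)\<^sup>*\<^sup>* u v"
    using assms by (auto simp: conn_def)
  then have "v \<notin> S \<Longrightarrow> \<exists>a b. a \<in> C \<and> b \<in> C \<and> E a b \<and> a \<in> S \<and> b \<notin> S"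
    using assms(4) by (induction) blast+
  then show ?thesis using assms(5) that by blast
qed

lemma conn_singleton: "conn {x}"
  by (auto simp: conn_def)

lemma conn_Un:
  assumes "conn D" "\<And>q. q \<in> Q \<Longrightarrow> \<exists>d\<in>D. E q d"
  shows "conn (D \<union> Q)"
proof -
  let ?R = "\<lambda>a b. a \<in> D \<union> Q \<and> b \<in> D \<union> Q \<and> E a b"
  have D: "?R\<^sup>*\<^sup>* u v" if "u \<in> D" "v \<in> D" for u v
  proof -
    have "(\<lambda>a b. a \<in> D \<and> b \<in> D \<and> E a b)\<^sup>*\<^sup>* u v" using assms(1) that by (auto simp: conn_def)
    then show ?thesis by (rule rtranclp_mono[THEN predicate2D, rotated]) auto
  qed
  have r: "\<exists>d\<in>D. ?R\<^sup>*\<^sup>* u d \<and> ?R\<^sup>*\<^sup>* d u" if "u \<in> D \<union> Q" for u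
  proof (cases "u \<in> D")
    case False
    with that assms(2) obtain d where "d \<in> D" "E u d" by auto
    then have "?R u d" "?R d u" using that sym by auto
    then show ?thesis using \<open>d \<in> D\<close> by blast
  qed auto
  show ?thesis unfolding conn_def
  proof (intro ballI)
    fix u v assume "u \<in> D \<union> Q" "v \<in> D \<union> Q"
    then obtain d d' where "d \<in> D" "d' \<in> D" "?R\<^sup>*\<^sup>* u d" "?R\<^sup>*\<^sup>* d' v" using r by meson
    then show "?R\<^sup>*\<^sup>* u v" using D by (meson rtranclp_trans)
  qed
qed

text \<open>Chords are avoided by jumping from \<open>z\<close> to its last neighbour on the path,
  or by starting at \<open>z\<close> if the path contains it. The bound on \<open>butlast\<close>
  ensures that, apart from \<open>z\<close>, a set met only at the end of the old path is still met
  only there.\<close>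

lemma ipath_shorten:
  assumes "ipath zs" "w \<in> set zs" "E z w"
  obtains ws where "ipath (z # ws)" "set ws \<subseteq> set zs" "last (z # ws) = last zs"
    "set (butlast (z # ws)) \<subseteq> insert z (set (butlast zs))"
proof (cases "z \<in> set zs")
  case True
  then obtain as bs where zs: "zs = as @ z # bs" by (meson split_list)
  have "ipath (z # bs)" using assms(1) zs by (simp only: ipath_append)
  then show ?thesis using zs by (intro that[of bs]) (auto simp: butlast_append)
next
  case False
  obtain as w' bs where zs: "zs = as @ w' # bs" and w': "E z w'" "\<forall>b\<in>set bs. \<not> E z b"
    using split_list_last_prop[of zs "E z"] assms by blast
  have "ipath (w' # bs)" using assms(1) zs by (simp only: ipath_append)
  then have "ipath (z # w' # bs)" using w' False zs by auto
  then show ?thesis using zs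
    by (intro that[of "w' # bs"]) (auto simp: butlast_append)
qed

text \<open>Induction from the far end of the walk: a vertex outside \<open>T\<close> is put in
  front by \<open>ipath_shorten\<close>, and a vertex in \<open>T\<close> starts afresh as a
  one-vertex path.\<close>

lemma ipath_to_set:
  assumes "(\<lambda>a b. a \<in> C \<and> b \<in> C \<and> E a b)\<^sup>*\<^sup>* c s" "c \<in> C" "s \<in> C" "s \<in> T"
  shows "\<exists>zs. ipath (c # zs) \<and> set (c # zs) \<subseteq> C \<and> last (c # zs) \<in> T \<and>
    set (butlast (c # zs)) \<inter> T = {}"
  using assms
proof (induction rule: converse_rtranclp_induct)
  case base
  then show ?case by (intro exI[of _ "[]"]) auto
next
  case (step y z)
  show ?case
  proof (cases "y \<in> T")
    case True
    then show ?thesis using step.prems by (intro exI[of _ "[]"]) auto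
  next
    case False
    obtain zs where zs: "ipath (z # zs)" "set (z # zs) \<subseteq> C" "last (z # zs) \<in> T"
      "set (butlast (z # zs)) \<inter> T = {}" using step by blast
    obtain ws where ws: "ipath (y # ws)" "set ws \<subseteq> set (z # zs)" "last (y # ws) = last (z # zs)"
      "set (butlast (y # ws)) \<subseteq> insert y (set (butlast (z # zs)))"
      using ipath_shorten[OF zs(1), of z y] step.hyps by auto
    have "ipath (y # ws) \<and> set (y # ws) \<subseteq> C \<and> last (y # ws) \<in> T \<and> set (butlast (y # ws)) \<inter> T = {}"
      using ws zs False step.prems by (intro conjI) (auto simp del: last.simps butlast.simps)
    then show ?thesis by blast
  qed
qed

text \<open>Aiming at \<open>S\<close> together with its neighbours, rather than at
  \<open>S\<close>, stops the path as soon as it sees \<open>S\<close>; hence only its last vertex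
  has neighbours in \<open>S\<close>.\<close>

lemma connector:
  assumes "conn C" "x \<notin> C" "c \<in> C" "E x c" "S \<subseteq> C" "S \<noteq> {}"
  obtains ss where "ipath (x # ss)" "set ss \<subseteq> C - S"
    "\<forall>z\<in>set (butlast (x # ss)). \<forall>p\<in>S. \<not> E z p"
    "\<exists>p\<in>S. E (last (x # ss)) p"
proof (cases "\<exists>p\<in>S. E x p")
  case True
  then show ?thesis by (intro that[of "[]"]) auto
next
  case False
  define T where "T = S \<union> {z. \<exists>p\<in>S. E z p}"
  obtain s where s: "s \<in> S" using assms by auto
  have "(\<lambda>a b. a \<in> C \<and> b \<in> C \<and> E a b)\<^sup>*\<^sup>* c s" using assms s by (auto simp: conn_def)
  then obtain zs where zs: "ipath (c # zs)" "set (c # zs) \<subseteq> C" "last (c # zs) \<in> T"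
    "set (butlast (c # zs)) \<inter> T = {}"
    using ipath_to_set[of C c s T] assms(3,5) s unfolding T_def by blast
  obtain ws where ws: "ipath (x # ws)" "set ws \<subseteq> set (c # zs)" "last (x # ws) = last (c # zs)"
      "set (butlast (x # ws)) \<subseteq> insert x (set (butlast (c # zs)))"
    using ipath_shorten[OF zs(1), of c x] assms by auto
  have xT: "x \<notin> T" using False assms by (auto simp: T_def)
  then have bT: "set (butlast (x # ws)) \<inter> T = {}" using ws(4) zs(4) by blast
  have "last (x # ws) \<in> T" using ws zs by simp
  then have "ws \<noteq> []" using xT by auto
  then obtain us l where us: "ws = us @ [l]" by (metis append_butlast_last_id)
  have l: "l \<in> T" "l \<in> C" using \<open>last (x # ws) \<in> T\<close> us ws(2) zs(2) by auto
  \<comment> \<open>The predecessor of a vertex of \<open>S\<close> would already lie in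
    \<open>T\<close>.\<close>
  have "l \<notin> S"
  proof
    assume "l \<in> S"
    have "ipath ((x # us) @ [l])" using ws(1) us by simp
    then have "E (last (x # us)) l" unfolding ipath_append by simp
    then have "last (x # us) \<in> T" using \<open>l \<in> S\<close> by (auto simp: T_def)
    moreover have "last (x # us) \<in> set (butlast (x # ws))" using us by auto
    ultimately show False using bT by blast
  qed
  show ?thesis
  proof (rule that[OF ws(1)])
    show "set ws \<subseteq> C - S" using us bT ws(2) zs(2) \<open>l \<notin> S\<close> by (auto simp: T_def)
    show "\<forall>z\<in>set (butlast (x # ws)). \<forall>p\<in>S. \<not> E z p" using bT by (auto simp: T_def)
    show "\<exists>p\<in>S. E (last (x # ws)) p" using l us \<open>l \<notin> S\<close> by (auto simp: T_def)
  qed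
qed

text \<open>Adjacency of \<open>x\<close> and \<open>y\<close> is left open: a hole arises either from the edge between them or
  from a second such path elsewhere.\<close>

definition cpath :: "'a set \<Rightarrow> 'a \<Rightarrow> 'a list \<Rightarrow> 'a \<Rightarrow> bool" where
  "cpath C x zs y \<longleftrightarrow> zs \<noteq> [] \<and> set zs \<subseteq> C \<and> ipath zs \<and>
     (\<forall>z\<in>set zs. E x z \<longleftrightarrow> z = hd zs) \<and> (\<forall>z\<in>set zs. E y z \<longleftrightarrow> z = last zs)"

text \<open>Aimed at the neighbours of \<open>y\<close> in \<open>C\<close>,
  \<open>connector\<close> stops one vertex short of them; any such neighbour \<open>p\<close> seen
  from its end completes the path.\<close>

lemma cpath_exists:
  assumes "conn C" "x \<notin> C" "c \<in> C" "E x c" "d \<in> C" "E y d"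
  obtains zs where "cpath C x zs y"
proof -
  define S where "S = {p \<in> C. E y p}"
  obtain ss where ss: "ipath (x # ss)" "set ss \<subseteq> C - S"
    "\<forall>z\<in>set (butlast (x # ss)). \<forall>p\<in>S. \<not> E z p" "\<exists>p\<in>S. E (last (x # ss)) p"
    using connector[of C x c S] assms by (auto simp: S_def)
  obtain p where p: "p \<in> S" "E (last (x # ss)) p" using ss by auto
  have *: "\<forall>z\<in>set (x # ss). E z p \<longleftrightarrow> z = last (x # ss)"
  proof
    fix z assume "z \<in> set (x # ss)"
    then have "z \<in> set (butlast (x # ss)) \<or> z = last (x # ss)"
      by (metis in_set_butlastD append_butlast_last_id in_set_conv_decomp list.distinct(1)
          rotate1.simps(2) set_ConsD set_rotate1)
    then show "E z p \<longleftrightarrow> z = last (x # ss)" using ss(3) p by blast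
  qed
  have "cpath C x (ss @ [p]) y"
    unfolding cpath_def
  proof (intro conjI)
    show "set (ss @ [p]) \<subseteq> C" using ss p by (auto simp: S_def)
    have "ipath ((x # ss) @ [p])"
      using ss(1,2) p * assms unfolding ipath_append by (auto simp: S_def)
    then show "ipath (ss @ [p])" and "\<forall>z\<in>set (ss @ [p]). E x z \<longleftrightarrow> z = hd (ss @ [p])" by auto
    show "\<forall>z\<in>set (ss @ [p]). E y z \<longleftrightarrow> z = last (ss @ [p])"
      using ss(2) p by (auto simp: S_def)
  qed simp
  then show ?thesis by (rule that)
qed

text \<open>\<open>us\<close> leads from \<open>x\<close> and \<open>ss\<close> from
  \<open>y\<close> to the place where they meet, so \<open>ss\<close> is traversed backwards. If
  \<open>us\<close> is empty, \<open>x\<close> itself sees the end of \<open>ss\<close>; if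
  \<open>ss\<close> is empty, \<open>y\<close> sees the end of \<open>us\<close>.\<close>

lemma cpath_join:
  assumes "ipath us" "ipath (y # ss)" "set us \<subseteq> C" "set ss \<subseteq> C" "set us \<inter> set ss = {}"
    and "us \<noteq> [] \<or> ss \<noteq> []"
    and "\<forall>u\<in>set us. E x u \<longleftrightarrow> u = hd us"
    and "\<forall>s\<in>set (butlast ss). \<not> E x s"
    and "\<forall>s\<in>set (butlast (y # ss)). \<forall>u\<in>set us. \<not> E s u"
    and "\<forall>u\<in>set us. E (last (y # ss)) u \<longleftrightarrow> u = last us"
    and "ss \<noteq> [] \<Longrightarrow> E x (last ss) \<longleftrightarrow> us = []"
  shows "cpath C x (us @ rev ss) y"
proof (cases "ss = []")
  case True
  then show ?thesis using assms by (auto simp: cpath_def)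
next
  case False
  then obtain vs t where ss: "ss = vs @ [t]" by (metis append_butlast_last_id)
  have ipss: "ipath ss" using assms(2) by simp
  have t: "t \<notin> set vs" using ipath_distinct[OF ipss] ss by auto
  have cross: "\<forall>s\<in>set ss. \<forall>u\<in>set us. E u s \<longleftrightarrow> u = last us \<and> s = t"
  proof (intro ballI)
    fix s u assume s: "s \<in> set ss" and u: "u \<in> set us"
    show "E u s \<longleftrightarrow> u = last us \<and> s = t"
    proof (cases "s = t")
      case True
      then show ?thesis using assms(10) u ss sym by auto
    next
      case F: False
      then have "s \<in> set (butlast (y # ss))" using s ss by auto
      then show ?thesis using assms(9) u F sym by blast
    qed
  qed
  have ip: "ipath (us @ rev ss)"
    unfolding ipath_append ipath_rev using assms(1,5) ipss cross ss by auto
  have x: "\<forall>z\<in>set (us @ rev ss). E x z \<longleftrightarrow> z = hd (us @ rev ss)"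
  proof (cases "us = []")
    case True
    then show ?thesis using assms(8,11) ss t False by auto
  next
    case F: False
    then have "hd us \<in> set us" by simp
    then show ?thesis using F assms(5,7,8,11) ss False by (auto simp: hd_append)
  qed
  have y: "\<forall>z\<in>set (us @ rev ss). E y z \<longleftrightarrow> z = last (us @ rev ss)"
  proof -
    have "hd ss \<in> set ss" using False by simp
    then have "\<forall>u\<in>set us. \<not> E y u \<and> u \<noteq> hd ss" using assms(5,9) False by auto
    then show ?thesis using assms(2) False by (auto simp: last_rev)
  qed
  show ?thesis unfolding cpath_def using ip x y False assms(3,4) by auto
qed

section \<open>Components and bounded walks\<close>

definition component :: "'a set \<Rightarrow> 'a \<Rightarrow> 'a set" where
  "component S r = {v. (\<lambda>a b. a \<in> S \<and> b \<in> S \<and> E a b)\<^sup>*\<^sup>* r v}"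

lemma component_subset: "r \<in> S \<Longrightarrow> component S r \<subseteq> S"
proof
  fix v assume "r \<in> S" "v \<in> component S r"
  then have "(\<lambda>a b. a \<in> S \<and> b \<in> S \<and> E a b)\<^sup>*\<^sup>* r v" by (simp add: component_def)
  then show "v \<in> S" using \<open>r \<in> S\<close> by induction auto
qed

lemma component_self: "r \<in> component S r"
  by (simp add: component_def)

lemma component_closed:
  assumes "r \<in> S" "u \<in> component S r" "v \<in> S" "E u v"
  shows "v \<in> component S r"
proof -
  have "u \<in> S" using component_subset assms by blast
  then show ?thesis using assms unfolding component_def by (auto intro: rtranclp.rtrancl_into_rtrancl)
qed

lemma conn_component:
  assumes "r \<in> S"
  shows "conn (component S r)"
proof -
  let ?R = "\<lambda>a b. a \<in> component S r \<and> b \<in> component S r \<and> E a b"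
  have from_r: "?R\<^sup>*\<^sup>* r v" if "v \<in> component S r" for v
  proof -
    have "(\<lambda>a b. a \<in> S \<and> b \<in> S \<and> E a b)\<^sup>*\<^sup>* r v" using that by (simp add: component_def)
    then show ?thesis
    proof induction
      case (step y z)
      then have "y \<in> component S r" "z \<in> component S r"
        unfolding component_def by (auto intro: rtranclp.rtrancl_into_rtrancl)
      then have "?R y z" using step by blast
      then show ?case using step.IH by (rule rtranclp.rtrancl_into_rtrancl[rotated])
    qed simp
  qed
  have "symp ?R" using sym by (auto intro: sympI)
  then have "symp ?R\<^sup>*\<^sup>*" by (rule symp_rtranclp)
  then have "?R\<^sup>*\<^sup>* u r" if "u \<in> component S r" for u using from_r[OF that] by (rule sympD)
  then show ?thesis unfolding conn_def using from_r by (meson rtranclp_trans)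
qed

text \<open>Walks suffice, since only an upper bound on the number of rounds until a cop arrives is
  ever wanted.\<close>

primrec near :: "nat \<Rightarrow> 'a \<Rightarrow> 'a \<Rightarrow> bool" where
  "near 0 u v \<longleftrightarrow> u = v"
| "near (Suc d) u v \<longleftrightarrow> u = v \<or> (\<exists>w. E u w \<and> near d w v)"

lemma near_ipath: "ipath (x # zs) \<Longrightarrow> E (last (x # zs)) y \<Longrightarrow> near (Suc (length zs)) x y"
proof (induction zs arbitrary: x)
  case (Cons z zs)
  then have "near (Suc (length zs)) z y" "E x z" by auto
  then show ?case by auto
qed auto

lemma near_cpath:
  assumes "cpath C x zs y" "x \<notin> C"
  shows "near (Suc (length zs)) x y"
proof (rule near_ipath)
  show "ipath (x # zs)" using assms by (auto simp: cpath_def)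
  have "E y (last zs)" "zs \<noteq> []" using assms by (auto simp: cpath_def)
  then show "E (last (x # zs)) y" using sym by simp
qed

end

section \<open>Parity of induced paths\<close>

text \<open>A hole is presented as an induced path \<open>zs\<close> closed up by a vertex
  \<open>v\<close> that sees just its two ends. It has \<open>length zs + 1\<close> vertices, so an
  even \<open>length zs\<close> means an odd hole.\<close>

locale claw_even_hole_free_graph = simple_graph +
  assumes claw: "\<lbrakk>E c x; E c y; E c z; x \<noteq> y; x \<noteq> z; y \<noteq> z\<rbrakk> \<Longrightarrow> E x y \<or> E x z \<or> E y z"
    and hole: "\<lbrakk>ipath zs; 3 \<le> length zs; v \<notin> set zs;
      \<forall>z\<in>set zs. E v z \<longleftrightarrow> z = hd zs \<or> z = last zs\<rbrakk> \<Longrightarrow> even (length zs)"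
begin

lemma no_C4:
  assumes "E a b" "E b c" "E c d" "E d a" "\<not> E a c" "\<not> E b d" "a \<noteq> c" "b \<noteq> d"
  shows False
proof -
  have "ipath [b, c, d]" using assms irrefl by auto
  then show False using hole[of "[b, c, d]" a] assms irrefl adj_commute[of a d] by auto
qed

text \<open>The edge between \<open>x\<close> and \<open>y\<close> closes the path to an induced
  cycle on \<open>length zs + 2\<close> vertices: a triangle if \<open>zs\<close> is a single
  vertex, an odd hole otherwise.\<close>

lemma odd_cpath_adj:
  assumes "cpath C x zs y" "E x y" "x \<notin> C" "y \<notin> C"
  shows "odd (length zs)"
proof (cases "length zs = 1")
  case False
  have zs: "zs \<noteq> []" "set zs \<subseteq> C" "ipath zs" "\<forall>z\<in>set zs. E x z \<longleftrightarrow> z = hd zs"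
    "\<forall>z\<in>set zs. E y z \<longleftrightarrow> z = last zs" using assms(1) by (auto simp: cpath_def)
  have l: "2 \<le> length zs" using False zs(1) by (cases zs) (auto simp: Suc_le_eq)
  have "ipath (zs @ [y])" unfolding ipath_append using zs assms(4) adj_commute[of _ y] by auto
  moreover have "x \<notin> set (zs @ [y])" using zs assms irrefl by auto
  moreover have "\<forall>z\<in>set (zs @ [y]). E x z \<longleftrightarrow> z = hd (zs @ [y]) \<or> z = last (zs @ [y])"
    using zs assms by auto
  ultimately have "even (length (zs @ [y]))" using l by (intro hole) auto
  then show ?thesis by simp
qed simp

definition separated :: "'a set \<Rightarrow> 'a set \<Rightarrow> bool" where
  "separated C D \<longleftrightarrow> conn C \<and> conn D \<and> C \<inter> D = {} \<and> (\<forall>c\<in>C. \<forall>d\<in>D. \<not> E c d)"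

definition linked :: "'a \<Rightarrow> 'a set \<Rightarrow> bool" where
  "linked x C \<longleftrightarrow> x \<notin> C \<and> (\<exists>c\<in>C. E x c)"

text \<open>For \<open>x\<close> outside \<open>C\<close>, this is simpliciality of \<open>x\<close>
  in the subgraph induced on \<open>C\<close> and \<open>x\<close>.\<close>

definition simplicial_to :: "'a \<Rightarrow> 'a set \<Rightarrow> bool" where
  "simplicial_to x C \<longleftrightarrow> (\<forall>u\<in>C. \<forall>v\<in>C. E x u \<and> E x v \<and> u \<noteq> v \<longrightarrow> E u v)"

lemma separated_sym:
  assumes "separated C D"
  shows "separated D C"
proof -
  have "\<not> E d c" if "c \<in> C" "d \<in> D" for c d
    using assms that sym[of d c] unfolding separated_def by blast
  moreover have "conn C" "conn D" "C \<inter> D = {}" using assms unfolding separated_def by auto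
  ultimately show ?thesis unfolding separated_def by auto
qed

text \<open>Two nonadjacent neighbours of \<open>x\<close> in \<open>C\<close> and one in
  \<open>D\<close> would be the leaves of a claw centred at \<open>x\<close>.\<close>

lemma separated_simplicial:
  assumes "separated C D" "linked x D"
  shows "simplicial_to x C"
  unfolding simplicial_to_def
proof (intro ballI impI)
  fix u v assume uv: "u \<in> C" "v \<in> C" "E x u \<and> E x v \<and> u \<noteq> v"
  obtain d where d: "d \<in> D" "E x d" using assms by (auto simp: linked_def)
  then have "\<not> E u d" "\<not> E v d" "u \<noteq> d" "v \<noteq> d" using assms uv by (auto simp: separated_def)
  then show "E u v" using claw[of x u v d] uv d by auto
qed

text \<open>The paths run on different sides of the separation, so together with \<open>x\<close>
  and \<open>y\<close> they form a hole on \<open>length zs + length ws + 2\<close>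
  vertices.\<close>

lemma odd_cpaths_nonadj:
  assumes "separated C D" "cpath C x zs y" "cpath D x ws y" "\<not> E x y" "x \<noteq> y"
    and "x \<notin> C" "x \<notin> D" "y \<notin> C" "y \<notin> D"
  shows "odd (length zs + length ws)"
proof -
  have zs: "zs \<noteq> []" "set zs \<subseteq> C" "ipath zs" "\<forall>z\<in>set zs. E x z \<longleftrightarrow> z = hd zs"
    "\<forall>z\<in>set zs. E y z \<longleftrightarrow> z = last zs" using assms by (auto simp: cpath_def)
  have ws: "ws \<noteq> []" "set ws \<subseteq> D" "ipath ws" "\<forall>z\<in>set ws. E x z \<longleftrightarrow> z = hd ws"
    "\<forall>z\<in>set ws. E y z \<longleftrightarrow> z = last ws" using assms by (auto simp: cpath_def)
  have yw: "ipath (y # rev ws)" using ws assms by (auto simp: ipath_rev hd_rev)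
  have "\<forall>u\<in>set zs. \<forall>v\<in>set (y # rev ws). E u v \<longleftrightarrow> u = last zs \<and> v = hd (y # rev ws)"
  proof (intro ballI)
    fix u v assume uv: "u \<in> set zs" "v \<in> set (y # rev ws)"
    show "E u v \<longleftrightarrow> u = last zs \<and> v = hd (y # rev ws)"
    proof (cases "v = y")
      case True
      then show ?thesis using zs(5) uv adj_commute[of u y] by simp
    next
      case False
      then have "u \<in> C" "v \<in> D" using uv zs(2) ws(2) by auto
      then show ?thesis using assms(1) False by (simp add: separated_def)
    qed
  qed
  moreover have "set zs \<inter> set (y # rev ws) = {}"
    using zs(2) ws(2) assms(1,8) unfolding separated_def by auto
  ultimately have "ipath (zs @ y # rev ws)"
    unfolding ipath_append using zs(3) yw by blast
  moreover have "3 \<le> length (zs @ y # rev ws)" using zs(1) ws(1)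
    by (cases zs; cases ws) auto
  moreover have "x \<notin> set (zs @ y # rev ws)" using zs(2) ws(2) assms(5-7) by auto
  moreover have "\<forall>z\<in>set (zs @ y # rev ws). E x z \<longleftrightarrow> z = hd (zs @ y # rev ws) \<or> z = last (zs @ y # rev ws)"
  proof -
    have "hd zs \<in> C" "hd ws \<in> D" using zs ws by auto
    moreover have "last (zs @ y # rev ws) = hd ws" using ws by (simp add: last_rev)
    moreover have "C \<inter> D = {}" using assms(1) by (simp add: separated_def)
    ultimately show ?thesis using zs(1,2,4) ws(2,4) assms(4,8,9) by auto
  qed
  ultimately have "even (length (zs @ y # rev ws))" by (rule hole)
  then show ?thesis by simp
qed

text \<open>A shortest connection from \<open>x3\<close> to an induced path from \<open>x1\<close> to \<open>x2\<close> must end in a triangle. Cutting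
  the path there gives the legs; lengths count inner vertices, hence the even sum.\<close>

lemma tripod:
  assumes C: "conn C"
    and l: "linked x1 C" "linked x2 C" "linked x3 C"
    and s: "simplicial_to x1 C" "simplicial_to x2 C" "simplicial_to x3 C"
    and ne: "x1 \<noteq> x2" "x1 \<noteq> x3" "x2 \<noteq> x3"
    and n12: "E x1 x2 \<Longrightarrow> \<not> (\<exists>c\<in>C. E x1 c \<and> E x2 c)"
    and n13: "E x1 x3 \<Longrightarrow> \<not> (\<exists>c\<in>C. E x1 c \<and> E x3 c)"
    and n23: "E x2 x3 \<Longrightarrow> \<not> (\<exists>c\<in>C. E x2 c \<and> E x3 c)"
  obtains zs us vs where "cpath C x1 zs x2" "cpath C x1 us x3" "cpath C x2 vs x3"
    "even (length zs + length us + length vs)"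
proof -
  have nC: "x1 \<notin> C" "x2 \<notin> C" "x3 \<notin> C" using l by (auto simp: linked_def)
  obtain zs where zc: "cpath C x1 zs x2" using cpath_exists[OF C] l by (metis linked_def)
  then have zs: "zs \<noteq> []" "set zs \<subseteq> C" "ipath zs" "\<forall>z\<in>set zs. E x1 z \<longleftrightarrow> z = hd zs"
    "\<forall>z\<in>set zs. E x2 z \<longleftrightarrow> z = last zs" by (auto simp: cpath_def)
  obtain ss where ss: "ipath (x3 # ss)" "set ss \<subseteq> C - set zs"
    "\<forall>z\<in>set (butlast (x3 # ss)). \<forall>p\<in>set zs. \<not> E z p"
    "\<exists>p\<in>set zs. E (last (x3 # ss)) p"
  proof -
    obtain c where "c \<in> C" "E x3 c" using l(3) by (auto simp: linked_def)
    then show ?thesis using connector[OF C nC(3) _ _ zs(2)] zs(1) that by (metis set_empty)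
  qed
  \<comment> \<open>The prospective corner of the triangle; it is \<open>x3\<close> itself if the
    connection is empty.\<close>
  define t where "t = last (x3 # ss)"
  have tx: "t = x3" if "ss = []" using that by (simp add: t_def)
  have tC: "t \<in> C" "t \<notin> set zs" "t = last ss" if "ss \<noteq> []"
    using that subsetD[OF ss(2) last_in_set] by (auto simp: t_def)
  \<comment> \<open>The predecessor \<open>r\<close> of \<open>t\<close> sees no vertex of
    \<open>zs\<close>; it serves as the third leaf of claws centred at \<open>t\<close>.\<close>
  have prev: "\<exists>r. E t r \<and> r \<in> set (butlast (x3 # ss)) \<and> (r = x3 \<or> r \<in> set (butlast ss))" if "ss \<noteq> []"
  proof -
    define rs where "rs = butlast ss"
    then have rs: "ss = rs @ [t]" using that tC(3) by simp
    have "ipath ((x3 # rs) @ [t])" using ss(1) rs by simp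
    then have "E (last (x3 # rs)) t" unfolding ipath_append by simp
    then have "E t (last (x3 # rs))" by (rule sym)
    then show ?thesis using rs by (intro exI[of _ "last (x3 # rs)"]) auto
  qed
  \<comment> \<open>Consequently \<open>t\<close> sees at most two vertices of the induced path
    \<open>zs\<close>, and two only if they are consecutive.\<close>
  have clique: "E p q" if "p \<in> set zs" "q \<in> set zs" "E t p" "E t q" "p \<noteq> q" for p q
  proof (cases "ss = []")
    case True
    then show ?thesis using tx that zs(2) s(3) unfolding simplicial_to_def by blast
  next
    case False
    obtain r where r: "E t r" "r \<in> set (butlast (x3 # ss))" using prev[OF False] by (elim exE conjE)
    have "r \<in> insert x3 (set ss)" using r(2) by (auto dest: in_set_butlastD split: if_splits)
    then have "r \<notin> set zs" using nC ss(2) zs(2) by auto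
    then show ?thesis using claw[of t p q r] r that ss(3) sym by blast
  qed
  \<comment> \<open>Simpliciality of \<open>x\<close> would make \<open>r\<close> adjacent to the
    end of \<open>zs\<close> next to \<open>x\<close>, although \<open>t\<close> alone sees
    \<open>zs\<close>.\<close>
  have x_leg: "\<not> E x r" if x: "x = x1 \<or> x = x2" and r: "r \<in> set (butlast ss)" for x r
  proof
    assume "E x r"
    have rC: "r \<in> C" "r \<notin> set zs" using in_set_butlastD[OF r] ss(2) by auto
    obtain e where e: "e \<in> set zs" "E x e" using x zs by (metis hd_in_set last_in_set)
    then have "E r e" using x s \<open>E x r\<close> rC zs(2) unfolding simplicial_to_def by blast
    moreover have "r \<in> set (butlast (x3 # ss))" using r by (cases ss) auto
    ultimately show False using ss(3) e by blast
  qed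
  have x_t: "E t (hd zs)" if "ss \<noteq> []" "E x1 t"
    using that s(1) tC zs unfolding simplicial_to_def by (metis hd_in_set subsetD)
  \<comment> \<open>The claw has centre \<open>t\<close> and leaves \<open>x\<close>,
    \<open>p\<close> and the predecessor \<open>r\<close>. That \<open>r\<close> and
    \<open>x\<close> are not adjacent follows from \<open>x_leg\<close>, or from \<open>n13\<close>
    and \<open>n23\<close> if \<open>r\<close> is \<open>x3\<close>.\<close>
  have no_claw: False
    if nc: "ss \<noteq> []" "E x t" "x = x1 \<or> x = x2" "E t p" "p \<in> set zs \<or> p = x1 \<or> p = x2" "\<not> E x p" "p \<noteq> x" for x p
  proof -
    obtain r where r: "E t r" "r \<in> set (butlast (x3 # ss))" "r = x3 \<or> r \<in> set (butlast ss)"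
      using prev[OF nc(1)] by blast
    have rin: "r \<in> insert x3 (set ss)" using r(2) by (auto dest: in_set_butlastD split: if_splits)
    have xr: "\<not> E x' r" if xx: "x' = x1 \<or> x' = x2" "E x' t" for x'
      using r(3)
    proof
      assume "r = x3"
      then show ?thesis using n13 n23 xx r(1) sym tC(1)[OF nc(1)] by blast
    qed (use x_leg xx in blast)
    have "\<not> E p r" using nc(5)
    proof
      assume "p \<in> set zs"
      then show ?thesis using ss(3) r(2) sym by blast
    next
      assume "p = x1 \<or> p = x2"
      then show ?thesis using xr nc(4) sym by blast
    qed
    moreover have "r \<noteq> p" "r \<noteq> x" using rin nC ne ss(2) nc(3,5) zs(2) by auto
    ultimately show False using claw[of t x p r] nc r(1) xr sym by blast
  qed
  \<comment> \<open>The cut is made at the triangle: its corners besides \<open>t\<close> are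
    \<open>last us\<close> and \<open>hd vs\<close>, with \<open>x1\<close> or \<open>x2\<close> in
    place of an empty piece.\<close>
  have "\<exists>us vs. zs = us @ vs \<and> (\<forall>u\<in>set us. E t u \<longleftrightarrow> u = last us) \<and>
      (\<forall>v\<in>set vs. E t v \<longleftrightarrow> v = hd vs) \<and> (us = [] \<or> vs = [] \<longrightarrow> ss \<noteq> []) \<and>
      (ss \<noteq> [] \<longrightarrow> (E x1 t \<longleftrightarrow> us = []) \<and> (E x2 t \<longleftrightarrow> vs = []))"
  proof -
    obtain us p vs where sp: "zs = us @ p # vs" "E t p" "\<forall>u\<in>set us. \<not> E t u"
      using split_list_first_prop[of zs "E t"] ss(4) t_def by blast
    have ip: "ipath us" "ipath (p # vs)" "\<forall>u\<in>set us. \<forall>v\<in>set (p # vs). E u v \<longleftrightarrow> u = last us \<and> v = p"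
      using zs(3) unfolding sp(1) ipath_append by auto
    have dist: "distinct zs" using zs(3) by (rule ipath_distinct)
    have vs: "v = hd vs" if "v \<in> set vs" "E t v" for v
    proof -
      have "E p v" using clique[of p v] that sp dist by auto
      then show ?thesis using ip(2) that by auto
    qed
    have pz: "p \<in> set zs" using sp by simp
    show ?thesis
    proof (cases "vs \<noteq> [] \<and> E t (hd vs)")
      case True
      have hv: "hd vs \<in> set zs" "hd vs \<noteq> p" using True sp dist by auto
      have "\<not> E x1 t" if "ss \<noteq> []"
      proof
        assume x: "E x1 t"
        have "us = []" using x_t[OF that x] sp by (cases us) auto
        then have "\<not> E x1 (hd vs)" using hv zs(4) sp by auto
        then show False using no_claw[OF that x] True hv nC zs(2) by blast
      qed
      moreover have "\<not> E x2 t" if "ss \<noteq> []"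
      proof
        assume x: "E x2 t"
        have "last zs \<in> set vs" using True sp by simp
        then have "\<not> E x2 p" using zs(5) pz sp dist by auto
        then show False using no_claw[OF that x] sp(2) pz nC zs(2) by blast
      qed
      ultimately show ?thesis using True sp vs
        by (intro exI[of _ "us @ [p]"] exI[of _ vs]) auto
    next
      case False
      then have only: "\<forall>z\<in>set zs. E t z \<longleftrightarrow> z = p" using sp vs by auto
      \<comment> \<open>\<open>L\<close> and \<open>R\<close> are the neighbours of \<open>p\<close>
        on the way to \<open>x1\<close> and to \<open>x2\<close>. A claw at \<open>p\<close> with
        leaves \<open>L\<close>, \<open>R\<close>, \<open>t\<close> is avoided only if
        \<open>t\<close> sees one of them; as \<open>p\<close> is its only neighbour on
        \<open>zs\<close>, that one is \<open>x1\<close> or \<open>x2\<close>.\<close>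
      define L where "L = (if us = [] then x1 else last us)"
      define R where "R = (if vs = [] then x2 else hd vs)"
      have "E p L"
      proof (cases "us = []")
        case True
        then show ?thesis using zs(4) sp adj_commute by (auto simp: L_def)
      next
        case F: False
        then show ?thesis using ip(3) adj_commute by (auto simp: L_def)
      qed
      moreover have "E p R"
      proof (cases "vs = []")
        case True
        then show ?thesis using zs(5) sp adj_commute by (auto simp: R_def)
      next
        case F: False
        then show ?thesis using ip(2) by (auto simp: R_def)
      qed
      moreover have Lus: "us \<noteq> [] \<Longrightarrow> L \<in> set us" and Rvs: "vs \<noteq> [] \<Longrightarrow> R \<in> set vs"
        by (auto simp: L_def R_def)
      moreover have LR: "L \<noteq> R" "t \<noteq> L" "t \<noteq> R"
      proof -
        have "L = x1 \<or> L \<in> set us" "R = x2 \<or> R \<in> set vs" by (auto simp: L_def R_def)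
        moreover have "set us \<subseteq> C" "set vs \<subseteq> C" "set us \<inter> set vs = {}" using zs(2) sp dist by auto
        moreover have "t = x3 \<or> t \<in> C - set zs" using tx tC by auto
        ultimately show "L \<noteq> R" "t \<noteq> L" "t \<noteq> R" using nC ne sp by auto
      qed
      moreover have "\<not> E L R"
      proof (cases "us = []")
        case u: True
        show ?thesis
        proof (cases "vs = []")
          case True
          have "E x1 p" "E x2 p" using zs(4,5) pz u True sp by auto
          then show ?thesis using n12 u True pz zs(2) by (auto simp: L_def R_def)
        next
          case F: False
          then show ?thesis using u zs(4) sp dist Rvs by (auto simp: L_def)
        qed
      next
        case u: False
        show ?thesis
        proof (cases "vs = []")
          case True
          then have "\<not> E x2 L" using zs(5) sp dist Lus u by auto
          then show ?thesis using True adj_commute by (auto simp: R_def)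
        next
          case F: False
          then show ?thesis using ip(3) Lus Rvs u dist sp by auto
        qed
      qed
      ultimately have or: "E L t \<or> E R t" using claw[of p L R t] sp(2) sym by blast
      show ?thesis
      proof (cases "E L t")
        case True
        have u: "us = []" using True sp(3) Lus sym by blast
        then have x1t: "E x1 t" and hp: "hd zs = p" using True sp by (auto simp: L_def)
        \<comment> \<open>Otherwise \<open>t\<close> is \<open>x3\<close>, adjacent to
          \<open>x1\<close>, and \<open>p\<close> is a common neighbour of both, against
          \<open>n13\<close>.\<close>
        have sn: "ss \<noteq> []"
        proof
          assume "ss = []"
          then show False using n13 x1t tx sp(2) zs(2,4) pz hp by blast
        qed
        have "\<not> E x2 t"
        proof
          assume x: "E x2 t"
          then have "\<not> E x1 x2" using n12 x1t tC(1)[OF sn] by blast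
          then show False using no_claw[OF sn x1t, of x2] x ne sym by blast
        qed
        then show ?thesis using only hp sn x1t zs(1)
          by (intro exI[of _ "[]"] exI[of _ zs]) auto
      next
        case False
        then have R: "E R t" using or by simp
        have v: "vs = []"
        proof (rule ccontr)
          assume "vs \<noteq> []"
          then have "R \<in> set zs" "R \<noteq> p" using Rvs sp dist by auto
          then show False using only R sym by blast
        qed
        then have x2t: "E x2 t" and hp: "last zs = p" using R sp by (auto simp: R_def)
        have sn: "ss \<noteq> []"
        proof
          assume "ss = []"
          then show False using n23 x2t tx sp(2) zs(2,5) pz hp by blast
        qed
        have "\<not> E x1 t"
        proof
          assume x: "E x1 t"
          then have "\<not> E x1 x2" using n12 x2t tC(1)[OF sn] by blast
          then show False using no_claw[OF sn x, of x2] x2t ne sym by blast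
        qed
        then show ?thesis using only hp sn x2t zs(1)
          by (intro exI[of _ zs] exI[of _ "[]"]) auto
      qed
    qed
  qed
  then obtain us vs where sp: "zs = us @ vs" "\<forall>u\<in>set us. E t u \<longleftrightarrow> u = last us"
      "\<forall>v\<in>set vs. E t v \<longleftrightarrow> v = hd vs" "us = [] \<or> vs = [] \<longrightarrow> ss \<noteq> []"
      "ss \<noteq> [] \<longrightarrow> (E x1 t \<longleftrightarrow> us = []) \<and> (E x2 t \<longleftrightarrow> vs = [])"
    by blast
  have ip: "ipath us" "ipath vs" using zs(3) unfolding sp(1) ipath_append by auto
  have dist: "distinct zs" using zs(3) by (rule ipath_distinct)
  have "cpath C x1 (us @ rev ss) x3"
  proof (rule cpath_join)
    show "set us \<subseteq> C" "set ss \<subseteq> C" "set us \<inter> set ss = {}" using zs(2) ss(2) sp by auto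
    show "us \<noteq> [] \<or> ss \<noteq> []" using sp by auto
    show "\<forall>u\<in>set us. E x1 u \<longleftrightarrow> u = hd us" using zs(4) sp by (cases us) auto
    show "\<forall>s\<in>set (butlast ss). \<not> E x1 s" using x_leg by blast
    show "\<forall>s\<in>set (butlast (x3 # ss)). \<forall>u\<in>set us. \<not> E s u" using ss(3) sp by (metis Un_iff set_append)
    show "\<forall>u\<in>set us. E (last (x3 # ss)) u \<longleftrightarrow> u = last us" using sp t_def by simp
    show "E x1 (last ss) \<longleftrightarrow> us = []" if "ss \<noteq> []" using that sp tC by auto
  qed (use ip ss in auto)
  moreover have "cpath C x2 (rev vs @ rev ss) x3"
  proof (rule cpath_join)
    show "set (rev vs) \<subseteq> C" "set ss \<subseteq> C" "set (rev vs) \<inter> set ss = {}" using zs(2) ss(2) sp by auto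
    show "rev vs \<noteq> [] \<or> ss \<noteq> []" using sp by auto
    show "\<forall>u\<in>set (rev vs). E x2 u \<longleftrightarrow> u = hd (rev vs)"
      using zs(5) sp by (cases vs rule: rev_cases) auto
    show "\<forall>s\<in>set (butlast ss). \<not> E x2 s" using x_leg by blast
    show "\<forall>s\<in>set (butlast (x3 # ss)). \<forall>u\<in>set (rev vs). \<not> E s u" using ss(3) sp by (metis Un_iff set_append set_rev)
    show "\<forall>u\<in>set (rev vs). E (last (x3 # ss)) u \<longleftrightarrow> u = last (rev vs)"
      using sp t_def by (cases vs) auto
    show "E x2 (last ss) \<longleftrightarrow> rev vs = []" if "ss \<noteq> []" using that sp tC by auto
  qed (use ip ss in \<open>auto simp: ipath_rev\<close>)
  moreover have "even (length zs + length (us @ rev ss) + length (rev vs @ rev ss))"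
    using sp(1) by auto
  ultimately show ?thesis by (rule that[OF zc])
qed

section \<open>Excluding three boundary vertices with private neighbours\<close>

lemma linkedD: "linked x C \<Longrightarrow> x \<notin> C"
  by (simp add: linked_def)

lemma simplicialD: "simplicial_to x C \<Longrightarrow> u \<in> C \<Longrightarrow> v \<in> C \<Longrightarrow> E x u \<Longrightarrow> E x v \<Longrightarrow> u \<noteq> v \<Longrightarrow> E u v"
  by (simp add: simplicial_to_def)

lemma linked_cpath:
  assumes "conn C" "linked x C" "linked y C"
  obtains zs where "cpath C x zs y"
proof -
  obtain c where c: "x \<notin> C" "c \<in> C" "E x c" using assms(2) by (auto simp: linked_def)
  obtain d where d: "d \<in> C" "E y d" using assms(3) by (auto simp: linked_def)
  show ?thesis by (rule cpath_exists[OF assms(1) c d that])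
qed

text \<open>The three path lengths have even sum in \<open>C\<close> and in \<open>D\<close>. But
  for each pair the path through \<open>C\<close> and the path through \<open>D\<close> form a hole,
  so the overall sum is also a sum of three odd numbers.\<close>

lemma no_independent_triple:
  assumes sep: "separated C D"
    and C: "linked x1 C" "linked x2 C" "linked x3 C"
    and D: "linked x1 D" "linked x2 D" "linked x3 D"
    and ne: "x1 \<noteq> x2" "x1 \<noteq> x3" "x2 \<noteq> x3"
    and non: "\<not> E x1 x2" "\<not> E x1 x3" "\<not> E x2 x3"
  shows False
proof -
  have conn: "conn C" "conn D" using sep by (auto simp: separated_def)
  note sC = separated_simplicial[OF sep] and sD = separated_simplicial[OF separated_sym[OF sep]]
  obtain a b c where 1: "cpath C x1 a x2" "cpath C x1 b x3" "cpath C x2 c x3"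
      "even (length a + length b + length c)"
    using tripod[OF conn(1) C sC[OF D(1)] sC[OF D(2)] sC[OF D(3)] ne] non by blast
  obtain a' b' c' where 2: "cpath D x1 a' x2" "cpath D x1 b' x3" "cpath D x2 c' x3"
      "even (length a' + length b' + length c')"
    using tripod[OF conn(2) D sD[OF C(1)] sD[OF C(2)] sD[OF C(3)] ne] non by blast
  note nC = linkedD[OF C(1)] linkedD[OF C(2)] linkedD[OF C(3)]
  note nD = linkedD[OF D(1)] linkedD[OF D(2)] linkedD[OF D(3)]
  have "odd (length a + length a')"
    by (rule odd_cpaths_nonadj[OF sep 1(1) 2(1) non(1) ne(1) nC(1) nD(1) nC(2) nD(2)])
  moreover have "odd (length b + length b')"
    by (rule odd_cpaths_nonadj[OF sep 1(2) 2(2) non(2) ne(2) nC(1) nD(1) nC(3) nD(3)])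
  moreover have "odd (length c + length c')"
    by (rule odd_cpaths_nonadj[OF sep 1(3) 2(3) non(3) ne(3) nC(2) nD(2) nC(3) nD(3)])
  ultimately show False using 1(4) 2(4) by presburger
qed

text \<open>A common neighbour \<open>c\<close> would produce two induced paths to \<open>x3\<close> whose lengths differ by one.\<close>

lemma no_common_neighbour_aux:
  assumes s: "simplicial_to x1 C" "simplicial_to x2 C"
    and nC: "x3 \<notin> C"
    and par: "\<And>us vs. cpath C x1 us x3 \<Longrightarrow> cpath C x2 vs x3 \<Longrightarrow> even (length us + length vs)"
    and ss: "ipath (x3 # ss)" "set ss \<subseteq> C - {c \<in> C. E x1 c \<or> E x2 c}"
      "\<forall>r\<in>set (butlast (x3 # ss)). \<forall>p\<in>{c \<in> C. E x1 c \<or> E x2 c}. \<not> E r p"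
    and z: "z \<in> C" "E x1 z" "\<not> E x2 z" "E (last (x3 # ss)) z"
    and c: "c \<in> C" "E x1 c" "E x2 c" "\<not> E (last (x3 # ss)) c"
  shows False
proof -
  have cz: "E c z" "c \<noteq> z" using simplicialD[OF s(1) c(1) z(1)] c z by auto
  have "cpath C x1 ([z] @ rev ss) x3"
  proof (rule cpath_join)
    show "ss \<noteq> [] \<Longrightarrow> E x1 (last ss) \<longleftrightarrow> [z] = []" using ss(2) last_in_set[of ss] by blast
    show "\<forall>s\<in>set (butlast ss). \<not> E x1 s" using ss(2) in_set_butlastD by fast
  qed (use ss z in auto)
  moreover have "cpath C x2 ([c, z] @ rev ss) x3"
  proof (rule cpath_join)
    show "ss \<noteq> [] \<Longrightarrow> E x2 (last ss) \<longleftrightarrow> [c, z] = []" using ss(2) last_in_set[of ss] by blast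
    show "\<forall>s\<in>set (butlast ss). \<not> E x2 s" using ss(2) in_set_butlastD by fast
    show "\<forall>u\<in>set [c, z]. E (last (x3 # ss)) u \<longleftrightarrow> u = last [c, z]" using z c cz by auto
  qed (use ss z c cz in auto)
  ultimately have "even (length ([z] @ rev ss) + length ([c, z] @ rev ss))" by (rule par)
  then show False by simp
qed

text \<open>The connection from \<open>x3\<close> to \<open>Z\<close> ends in a vertex
  \<open>t\<close> that sees no common neighbour of \<open>x1\<close> and \<open>x2\<close>. So
  \<open>t\<close> enters \<open>Z\<close> at a vertex seen by exactly one of the two, and the
  preceding lemma applies.\<close>

lemma no_common_neighbour:
  assumes C: "conn C" and l: "linked x3 C"
    and s: "simplicial_to x1 C" "simplicial_to x2 C"
    and par: "\<And>us vs. cpath C x1 us x3 \<Longrightarrow> cpath C x2 vs x3 \<Longrightarrow> even (length us + length vs)"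
    and y1: "y1 \<in> C" "E x1 y1" "\<not> E x2 y1" "\<not> E x3 y1"
    and y2: "y2 \<in> C" "E x2 y2" "\<not> E x1 y2" "\<not> E x3 y2"
    and e: "E x1 x2"
    and nC12: "x1 \<notin> C" "x2 \<notin> C"
    and c: "c \<in> C" "E x1 c" "E x2 c"
  shows False
proof -
  define Z where "Z = {c \<in> C. E x1 c \<or> E x2 c}"
  have nC: "x3 \<notin> C" using l by (rule linkedD)
  \<comment> \<open>An edge between \<open>y1\<close> and \<open>y2\<close> would close the hole
    \<open>x1\<close>, \<open>y1\<close>, \<open>y2\<close>, \<open>x2\<close> of length 4.\<close>
  have y12: "y1 \<noteq> y2" "\<not> E y1 y2"
  proof -
    show "y1 \<noteq> y2" using y1 y2 by blast
    have "x1 \<noteq> y2" "y1 \<noteq> x2" using y1 y2 nC12 by blast+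
    then show "\<not> E y1 y2"
      using no_C4[of x1 y1 y2 x2] y1(2,3) y2(2,3) e sym by blast
  qed
  have Z: "y1 \<in> Z" "y2 \<in> Z" "c \<in> Z" "Z \<subseteq> C" using y1 y2 c by (auto simp: Z_def)
  obtain c0 where c0: "c0 \<in> C" "E x3 c0" using l by (auto simp: linked_def)
  obtain ss where ss: "ipath (x3 # ss)" "set ss \<subseteq> C - Z"
    "\<forall>r\<in>set (butlast (x3 # ss)). \<forall>p\<in>Z. \<not> E r p" "\<exists>p\<in>Z. E (last (x3 # ss)) p"
    using connector[OF C nC c0 Z(4)] Z(1) by blast
  define t where "t = last (x3 # ss)"
  \<comment> \<open>If \<open>t\<close> is \<open>x3\<close>, then \<open>c'\<close> is the centre
    of a claw with leaves \<open>y1\<close>, \<open>y2\<close>, \<open>t\<close>. Otherwise the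
    claws at \<open>c'\<close> with leaves \<open>x2\<close>, \<open>y1\<close>, \<open>t\<close>
    and \<open>x1\<close>, \<open>y2\<close>, \<open>t\<close> force \<open>t\<close> to see
    \<open>y1\<close> and \<open>y2\<close>, which gives a claw at \<open>t\<close> together with
    its predecessor.\<close>
  have nt: "\<not> E t c'" if c': "c' \<in> C" "E x1 c'" "E x2 c'" for c'
  proof
    assume tc: "E t c'"
    have cy: "E c' y1" "E c' y2"
      using simplicialD[OF s(1) c'(1) y1(1) c'(2) y1(2)] simplicialD[OF s(2) c'(1) y2(1) c'(3) y2(2)]
        c' y1(3) y2(3) by auto
    show False
    proof (cases "ss = []")
      case True
      then have "t = x3" by (simp add: t_def)
      moreover have "x3 \<noteq> y1" "x3 \<noteq> y2" using nC y1 y2 by auto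
      ultimately show False using claw[of c' y1 y2 x3] cy tc y12 y1(4) y2(4) sym by blast
    next
      case False
      then have tin: "t \<in> set ss" by (simp add: t_def)
      then have t: "\<not> E x1 t" "\<not> E x2 t" "t \<in> C" "t \<notin> Z" using ss(2) by (auto simp: Z_def)
      have ty: "E t y1" "E t y2"
      proof -
        have "E c' x1" "E c' x2" "E c' t" using c' tc sym by auto
        moreover have "x1 \<noteq> t" "x2 \<noteq> t" "x1 \<noteq> y2" "x2 \<noteq> y1" "y1 \<noteq> t" "y2 \<noteq> t"
          using nC12 t Z y1 y2 by auto
        ultimately show "E t y1" "E t y2"
          using claw[of c' x2 y1 t] claw[of c' x1 y2 t] cy t(1,2) y1(3) y2(3) sym by auto
      qed
      have "\<exists>r\<in>set (butlast (x3 # ss)). E r t"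
      proof -
        define rs where "rs = butlast ss"
        then have rs: "ss = rs @ [t]" using False t_def by simp
        have "ipath ((x3 # rs) @ [t])" using ss(1) rs by simp
        then have "E (last (x3 # rs)) t" unfolding ipath_append by simp
        then show ?thesis using rs by (intro bexI[of _ "last (x3 # rs)"]) auto
      qed
      then obtain r where r: "r \<in> set (butlast (x3 # ss))" "E r t" by blast
      then have "\<not> E r y1" "\<not> E r y2" using ss(3) Z by auto
      moreover have "r \<noteq> y1" "r \<noteq> y2"
        using in_set_butlastD[OF r(1)] ss(2) nC Z by auto
      ultimately show False using claw[of t y1 y2 r] ty r y12 sym by blast
    qed
  qed
  obtain z where z: "z \<in> Z" "E t z" using ss(4) t_def by blast
  then have "\<not> (E x1 z \<and> E x2 z)" using nt by (auto simp: Z_def)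
  then consider "E x1 z" "\<not> E x2 z" | "E x2 z" "\<not> E x1 z" using z by (auto simp: Z_def)
  then show False
  proof cases
    case 1
    show False
      by (rule no_common_neighbour_aux[OF s nC par ss(1) ss(2,3)[unfolded Z_def], of z c])
        (use 1 z nt c t_def Z in auto)
  next
    case 2
    have Z': "Z = {c \<in> C. E x2 c \<or> E x1 c}" by (auto simp: Z_def)
    show False
      by (rule no_common_neighbour_aux[OF s(2,1) nC _ ss(1) ss(2,3)[unfolded Z'], of z c])
        (use 2 z nt c t_def Z par in \<open>auto simp: add.commute\<close>)
  qed
qed

text \<open>\<open>x1\<close> and \<open>x2\<close> turn out to be twins towards \<open>D\<close>,
  so one path through \<open>D\<close> to \<open>x3\<close> serves both. It forces equal parity on
  their paths through \<open>C\<close> to \<open>x3\<close>. The even sum of the tripod then makes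
  the path between \<open>x1\<close> and \<open>x2\<close> even, which their edge forbids.\<close>

lemma no_edge_and_isolated:
  assumes sep: "separated C D"
    and C: "linked x3 C"
    and D: "linked x1 D" "linked x2 D" "linked x3 D"
    and y1: "y1 \<in> C" "E x1 y1" "\<not> E x2 y1" "\<not> E x3 y1"
    and y2: "y2 \<in> C" "E x2 y2" "\<not> E x1 y2" "\<not> E x3 y2"
    and nC: "x1 \<notin> C" "x2 \<notin> C"
    and e: "E x1 x2" "\<not> E x1 x3" "\<not> E x2 x3" "x1 \<noteq> x3" "x2 \<noteq> x3"
  shows False
proof -
  have conn: "conn C" "conn D" using sep by (auto simp: separated_def)
  have L: "linked x1 C" "linked x2 C" using nC y1 y2 by (auto simp: linked_def)
  note s = separated_simplicial[OF sep D(1)] separated_simplicial[OF sep D(2)]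
    separated_simplicial[OF sep D(3)]
  have yd: "\<not> E y d" "y \<noteq> d" if "y \<in> C" "d \<in> D" for y d
    using sep that unfolding separated_def by auto
  \<comment> \<open>A vertex \<open>d\<close> seen by \<open>x1\<close> only would be a leaf of a
    claw at \<open>x1\<close>, with leaves \<open>x2\<close> and \<open>y1\<close>; likewise with
    the roles exchanged.\<close>
  have "E x1 d \<longleftrightarrow> E x2 d" if d: "d \<in> D" for d
    using claw[of x1 d x2 y1] claw[of x2 d x1 y2] d yd y1 y2 e(1) sym linkedD[OF D(1)] linkedD[OF D(2)] nC
    by metis
  then have twin: "cpath D x1 ws x3 \<longleftrightarrow> cpath D x2 ws x3" for ws
    unfolding cpath_def by blast
  obtain ws where w1: "cpath D x1 ws x3" by (rule linked_cpath[OF conn(2) D(1,3)])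
  then have w2: "cpath D x2 ws x3" using twin by blast
  note nD = linkedD[OF D(1)] linkedD[OF D(2)] linkedD[OF D(3)] and nC3 = linkedD[OF C]
  have par: "even (length us + length vs)" if "cpath C x1 us x3" "cpath C x2 vs x3" for us vs
    using odd_cpaths_nonadj[OF sep that(1) w1 e(2,4) nC(1) nD(1) nC3 nD(3)]
      odd_cpaths_nonadj[OF sep that(2) w2 e(3,5) nC(2) nD(2) nC3 nD(3)] by presburger
  have "\<not> (\<exists>c\<in>C. E x1 c \<and> E x2 c)"
    using no_common_neighbour[OF conn(1) C s(1,2) par y1 y2 e(1) nC] by blast
  moreover have "x1 \<noteq> x2" using e(1) irrefl by auto
  ultimately obtain a b c where "cpath C x1 a x2" "cpath C x1 b x3" "cpath C x2 c x3"
      "even (length a + length b + length c)"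
    using tripod[OF conn(1) L C s _ e(4,5)] e by blast
  then show False using odd_cpath_adj[OF _ e(1) nC] par by (metis even_add add.assoc)
qed

text \<open>Each edge makes the induced paths between its ends odd. Equal parities rule out common
  neighbours, and then the tripod consists of three odd paths with even sum.\<close>

lemma no_private_triangle:
  assumes C: "conn C" and nC: "x1 \<notin> C" "x2 \<notin> C" "x3 \<notin> C"
    and s: "simplicial_to x1 C" "simplicial_to x2 C" "simplicial_to x3 C"
    and y1: "y1 \<in> C" "E x1 y1" "\<not> E x2 y1" "\<not> E x3 y1"
    and y2: "y2 \<in> C" "E x2 y2" "\<not> E x1 y2" "\<not> E x3 y2"
    and y3: "y3 \<in> C" "E x3 y3" "\<not> E x1 y3" "\<not> E x2 y3"
    and e: "E x1 x2" "E x1 x3" "E x2 x3"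
  shows False
proof -
  have L: "linked x1 C" "linked x2 C" "linked x3 C" using nC y1 y2 y3 by (auto simp: linked_def)
  have od: "odd (length zs)" if "cpath C x zs y" "E x y" "x \<in> {x1, x2, x3}" "y \<in> {x1, x2, x3}" for x zs y
    using odd_cpath_adj[OF that(1,2)] that(3,4) nC by auto
  have par: "even (length us + length vs)"
    if "cpath C x us z" "cpath C y vs z" "E x z" "E y z" "{x, y, z} \<subseteq> {x1, x2, x3}" for us vs x y z
    using od[OF that(1)] od[OF that(2)] that(3-5) by auto
  have "\<not> (\<exists>c\<in>C. E x1 c \<and> E x2 c)"
    using no_common_neighbour[OF C L(3) s(1,2) par[OF _ _ e(2,3)] y1 y2 e(1) nC(1,2)] by blast
  moreover have "\<not> (\<exists>c\<in>C. E x1 c \<and> E x3 c)"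
    using no_common_neighbour[OF C L(2) s(1,3) par[OF _ _ e(1) sym[OF e(3)]] y1(1,2,4,3) y3(1,2,3,4) e(2) nC(1,3)]
    by blast
  moreover have "\<not> (\<exists>c\<in>C. E x2 c \<and> E x3 c)"
    using no_common_neighbour[OF C L(1) s(2,3) par[OF _ _ sym[OF e(1)] sym[OF e(2)]] y2(1,2,4,3) y3(1,2,4,3) e(3) nC(2,3)]
    by blast
  moreover have "x1 \<noteq> x2" "x1 \<noteq> x3" "x2 \<noteq> x3" using e irrefl by auto
  ultimately obtain a b c where "cpath C x1 a x2" "cpath C x1 b x3" "cpath C x2 c x3"
      "even (length a + length b + length c)"
    using tripod[OF C L s] by blast
  then show False using od e by auto
qed

lemma no_private_path:
  assumes "E x1 x2" "E x2 x3" "\<not> E x1 x3" "x1 \<noteq> x3" "E x2 y" "\<not> E x1 y" "\<not> E x3 y" "y \<noteq> x1" "y \<noteq> x3"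
  shows False
  using claw[of x2 x1 x3 y] assms sym by blast

text \<open>Distinguished by the edges among the three vertices: three edges are the triangle case,
  two give a claw at the middle vertex, one leaves an isolated vertex, none is the independent
  case.\<close>

lemma no_private_triple:
  assumes sep: "separated C D"
    and D: "linked x1 D" "linked x2 D" "linked x3 D"
    and nC: "x1 \<notin> C" "x2 \<notin> C" "x3 \<notin> C"
    and y1: "y1 \<in> C" "E x1 y1" "\<not> E x2 y1" "\<not> E x3 y1"
    and y2: "y2 \<in> C" "E x2 y2" "\<not> E x1 y2" "\<not> E x3 y2"
    and y3: "y3 \<in> C" "E x3 y3" "\<not> E x1 y3" "\<not> E x2 y3"
  shows False
proof -
  have L: "linked x1 C" "linked x2 C" "linked x3 C" using nC y1 y2 y3 by (auto simp: linked_def)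
  note s = separated_simplicial[OF sep D(1)] separated_simplicial[OF sep D(2)]
    separated_simplicial[OF sep D(3)]
  have conn: "conn C" using sep by (auto simp: separated_def)
  have ne: "x1 \<noteq> x2" "x1 \<noteq> x3" "x2 \<noteq> x3" using y1 y2 by auto
  have yx: "y1 \<noteq> x2" "y1 \<noteq> x3" "y2 \<noteq> x1" "y2 \<noteq> x3" "y3 \<noteq> x1" "y3 \<noteq> x2" using nC y1 y2 y3 by auto
  show False
  proof (cases "E x1 x2")
    case 12: True
    show ?thesis
    proof (cases "E x1 x3")
      case 13: True
      show ?thesis
      proof (cases "E x2 x3")
        case True
        then show ?thesis using no_private_triangle[OF conn nC s y1 y2 y3 12 13] by blast
      next
        case False
        then show ?thesis
          using no_private_path[of x2 x1 x3 y1] 12 13 sym ne y1 yx by blast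
      qed
    next
      case 13: False
      show ?thesis
      proof (cases "E x2 x3")
        case True
        then show ?thesis
          using no_private_path[of x1 x2 x3 y2] 12 13 sym ne y2 yx by blast
      next
        case False
        then show ?thesis
          using no_edge_and_isolated[OF sep L(3) D y1 y2 nC(1,2) 12 13 _ ne(2,3)] by blast
      qed
    qed
  next
    case 12: False
    show ?thesis
    proof (cases "E x1 x3")
      case 13: True
      show ?thesis
      proof (cases "E x2 x3")
        case True
        then show ?thesis
          using no_private_path[of x1 x3 x2 y3] 12 13 sym ne y3 yx by blast
      next
        case False
        then have "\<not> E x3 x2" using sym by blast
        then show ?thesis
          using no_edge_and_isolated[OF sep L(2) D(1,3,2) y1(1,2,4,3) y3 nC(1,3) 13 12 _ ne(1) ne(3)[symmetric]]
          by blast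
      qed
    next
      case 13: False
      show ?thesis
      proof (cases "E x2 x3")
        case True
        have "\<not> E x2 x1" "\<not> E x3 x1" using 12 13 sym by blast+
        then show ?thesis
          using no_edge_and_isolated[OF sep L(1) D(2,3,1) y2(1,2,4,3) y3(1,2,4,3) nC(2,3) True _ _
              ne(1,2)[symmetric]] by blast
      next
        case False
        then show ?thesis
          using no_independent_triple[OF sep L D ne 12 13] by blast
      qed
    qed
  qed
qed

section \<open>Covering the boundary of a territory\<close>

definition nbrs :: "'a set \<Rightarrow> 'a set" where
  "nbrs C = {q. linked q C}"

definition seen :: "'a set \<Rightarrow> 'a set \<Rightarrow> 'a set" where
  "seen Q C = {c \<in> C. \<exists>q\<in>Q. E q c}"

text \<open>With cops on \<open>x\<close> and \<open>y\<close>, a robber who ends his move on a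
  vertex of \<open>C\<close> that has a neighbour outside can be caught at once.\<close>

definition covers :: "'a set \<Rightarrow> 'a \<Rightarrow> 'a \<Rightarrow> bool" where
  "covers C x y \<longleftrightarrow> (\<forall>c\<in>seen (nbrs C) C. E x c \<or> E y c)"

text \<open>In a dominating set of least cardinality every member has a private vertex, since it
  could be dropped otherwise; three members would contradict
  \<open>no_private_triple\<close>.\<close>

lemma two_cover:
  assumes sep: "separated C D" and Q: "\<And>q. q \<in> nbrs C \<Longrightarrow> linked q D"
    and fin: "finite (nbrs C)" and ne: "nbrs C \<noteq> {}"
  obtains x y where "x \<in> nbrs C" "y \<in> nbrs C" "covers C x y"
proof -
  define P where "P M \<longleftrightarrow> M \<subseteq> nbrs C \<and> (\<forall>c\<in>seen (nbrs C) C. \<exists>m\<in>M. E m c)" for M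
  have "P (nbrs C)" by (auto simp: P_def seen_def)
  then obtain M where M: "P M" "\<And>M'. P M' \<Longrightarrow> card M \<le> card M'"
    using ex_has_least_nat[of P "nbrs C" card] by blast
  have finM: "finite M" using M(1) fin finite_subset by (auto simp: P_def)
  have priv: "\<exists>c\<in>C. E m c \<and> (\<forall>m'\<in>M - {m}. \<not> E m' c)" if "m \<in> M" for m
  proof (rule ccontr)
    assume "\<not> ?thesis"
    then have "P (M - {m})" using M(1) unfolding P_def seen_def by blast
    then have "card M \<le> card (M - {m})" by (rule M(2))
    then show False using that finM card_Diff1_less[of M m] by simp
  qed
  have MQ: "M \<subseteq> nbrs C" using M(1) by (simp add: P_def)
  have "card M \<le> 2"
  proof (rule ccontr)
    assume "\<not> card M \<le> 2"
    then have "3 \<le> card M" by simp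
    then obtain T where "T \<subseteq> M" "card T = 3" using obtain_subset_with_card_n by metis
    then obtain x1 x2 x3 where x: "{x1, x2, x3} \<subseteq> M" "x1 \<noteq> x2" "x1 \<noteq> x3" "x2 \<noteq> x3"
      by (auto simp: card_3_iff)
    then have "linked x1 D" "linked x2 D" "linked x3 D" using MQ Q by auto
    moreover have "x1 \<notin> C" "x2 \<notin> C" "x3 \<notin> C" using MQ x by (auto simp: nbrs_def linked_def)
    moreover obtain y1 where "y1 \<in> C" "E x1 y1" "\<not> E x2 y1" "\<not> E x3 y1" using priv[of x1] x by auto
    moreover obtain y2 where "y2 \<in> C" "E x2 y2" "\<not> E x1 y2" "\<not> E x3 y2" using priv[of x2] x by auto
    moreover obtain y3 where "y3 \<in> C" "E x3 y3" "\<not> E x1 y3" "\<not> E x2 y3" using priv[of x3] x by auto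
    ultimately show False by (rule no_private_triple[OF sep])
  qed
  moreover have "M \<noteq> {}"
  proof
    assume "M = {}"
    obtain q where "q \<in> nbrs C" using ne by blast
    then obtain c where "c \<in> C" "E q c" by (auto simp: nbrs_def linked_def)
    then have "c \<in> seen (nbrs C) C" using \<open>q \<in> nbrs C\<close> by (auto simp: seen_def)
    then show False using M(1) \<open>M = {}\<close> by (auto simp: P_def)
  qed
  ultimately have "card M = 1 \<or> card M = 2" using finM by (cases "card M") (auto simp: card_eq_0_iff)
  \<comment> \<open>A single dominating vertex is the case \<open>x = y\<close>.\<close>
  then have "\<exists>x y. M = {x, y}"
  proof
    assume "card M = 1"
    then obtain x where "M = {x}" by (auto simp: card_1_singleton_iff)
    then show ?thesis by (intro exI[of _ x]) auto
  qed (auto simp: card_2_iff)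
  then obtain x y where "M = {x, y}" by blast
  then show ?thesis using M(1) MQ that[of x y] by (auto simp: P_def covers_def)
qed

lemma covers_commute: "covers C x y \<longleftrightarrow> covers C y x"
  by (auto simp: covers_def)

text \<open>Both covering vertices are reachable from \<open>a\<close>, so one of them is to be
  exchanged for \<open>w\<close>, reachable from \<open>b\<close>. If both exchanges fail, the
  uncovered vertices are private to \<open>x\<close> and to \<open>y\<close>, and \<open>w\<close>
  is isolated from the edge between these.\<close>

lemma matched_cover_aux:
  assumes sep: "separated C D" and Q: "\<And>q. q \<in> nbrs C \<Longrightarrow> linked q D"
    and ab: "a \<in> D" "b \<in> D" "\<And>q. q \<in> nbrs C \<Longrightarrow> E a q \<or> E b q"
    and clA: "\<And>u v. u \<in> nbrs C \<Longrightarrow> v \<in> nbrs C \<Longrightarrow> E a u \<Longrightarrow> E a v \<Longrightarrow> u \<noteq> v \<Longrightarrow> E u v"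
    and w: "w \<in> nbrs C" "\<not> E a w"
    and xy: "x \<in> nbrs C" "y \<in> nbrs C" "covers C x y" "E a x" "E a y"
  shows "\<exists>x\<in>nbrs C. \<exists>y\<in>nbrs C. E a x \<and> E b y \<and> covers C x y"
proof (rule ccontr)
  assume no: "\<not> ?thesis"
  have bw: "E b w" using ab w by blast
  have "\<not> covers C y w" "\<not> covers C x w" using no xy w bw by blast+
  then obtain y1 y2 where y: "y1 \<in> seen (nbrs C) C" "\<not> E y y1" "\<not> E w y1"
      "y2 \<in> seen (nbrs C) C" "\<not> E x y2" "\<not> E w y2"
    unfolding covers_def by blast
  then have y': "E x y1" "E y y2" "y1 \<in> C" "y2 \<in> C" using xy(3) by (auto simp: covers_def seen_def)
  have "x \<noteq> y" using y y' by blast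
  then have "E x y" using clA xy by blast
  have nC: "x \<notin> C" "y \<notin> C" "w \<notin> C" using xy w by (auto simp: nbrs_def linked_def)
  have ay: "\<not> E a y1" "\<not> E a y2" "a \<noteq> y1" "a \<noteq> y2"
    using sep ab(1) y'(3,4) sym[of a] unfolding separated_def by blast+
  have wa: "w \<noteq> a" "x \<noteq> w" "y \<noteq> w" using w xy Q[OF w(1)] ab(1) by (auto simp: linked_def)
  \<comment> \<open>Otherwise \<open>x\<close> is the centre of a claw with leaves \<open>a\<close>,
    \<open>w\<close>, \<open>y1\<close>.\<close>
  have "\<not> E x w" using claw[of x a w y1] xy(4) w(2) y y' ay wa nC sym by metis
  moreover have "\<not> E y w" using claw[of y a w y2] xy(5) w(2) y y' ay wa nC sym by metis
  moreover have "linked w C" using w by (simp add: nbrs_def)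
  ultimately show False
    using no_edge_and_isolated[OF sep _ Q[OF xy(1)] Q[OF xy(2)] Q[OF w(1)] y'(3,1) y(2,3) y'(4,2) y(5,6) nC(1,2)]
      \<open>E x y\<close> wa by blast
qed

text \<open>The cops on \<open>a\<close> and \<open>b\<close> must reach the two covering vertices
  in a single move, each cop one of them.\<close>

lemma matched_cover:
  assumes sep: "separated C D" and Q: "\<And>q. q \<in> nbrs C \<Longrightarrow> linked q D"
    and fin: "finite (nbrs C)"
    and ab: "a \<in> D" "b \<in> D" "\<And>q. q \<in> nbrs C \<Longrightarrow> E a q \<or> E b q"
    and clA: "\<And>u v. u \<in> nbrs C \<Longrightarrow> v \<in> nbrs C \<Longrightarrow> E a u \<Longrightarrow> E a v \<Longrightarrow> u \<noteq> v \<Longrightarrow> E u v"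
    and clB: "\<And>u v. u \<in> nbrs C \<Longrightarrow> v \<in> nbrs C \<Longrightarrow> E b u \<Longrightarrow> E b v \<Longrightarrow> u \<noteq> v \<Longrightarrow> E u v"
    and w: "w \<in> nbrs C" "\<not> E a w" "w' \<in> nbrs C" "\<not> E b w'"
  obtains x y where "x \<in> nbrs C" "y \<in> nbrs C" "E a x" "E b y" "covers C x y"
proof -
  obtain x y where xy: "x \<in> nbrs C" "y \<in> nbrs C" "covers C x y"
    using two_cover[OF sep Q fin] w by blast
  consider "E a x" "E b y" | "E b x" "E a y" | "E a x" "E a y" | "E b x" "E b y"
    using ab(3)[OF xy(1)] ab(3)[OF xy(2)] by blast
  then have "\<exists>x\<in>nbrs C. \<exists>y\<in>nbrs C. E a x \<and> E b y \<and> covers C x y"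
  proof cases
    case 1
    then show ?thesis using xy by blast
  next
    case 2
    then show ?thesis using xy covers_commute by blast
  next
    case 3
    show ?thesis by (rule matched_cover_aux[OF sep Q ab clA w(1,2) xy 3])
  next
    case 4
    have "E b q \<or> E a q" if "q \<in> nbrs C" for q using ab(3)[OF that] by blast
    from matched_cover_aux[OF sep Q ab(2,1) this clB w(3,4) xy 4] show ?thesis
      using covers_commute by blast
  qed
  then show ?thesis using that by blast
qed

end

section \<open>The game\<close>

locale cops_arena = claw_even_hole_free_graph +
  fixes V :: "'a set"
  assumes finite_V: "finite V" and E_V: "E u v \<Longrightarrow> u \<in> V"
begin

lemma nbrs_V: "nbrs C \<subseteq> V"
  using E_V by (auto simp: nbrs_def linked_def)

lemma finite_nbrs: "finite (nbrs C)"
  using nbrs_V finite_V finite_subset by blast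

section \<open>Moves and winning positions\<close>

definition mv :: "'a \<Rightarrow> 'a \<Rightarrow> bool" where
  "mv u v \<longleftrightarrow> u \<in> V \<and> (v = u \<or> E u v)"

lemma mv_V: "mv u v \<Longrightarrow> v \<in> V"
  using E_V sym by (auto simp: mv_def)

text \<open>Positions are taken at the end of a round, with the cops to move and \<open>k\<close>
  more rounds available. A capture by the cops' half of a round leaves the robber no reply.\<close>

primrec wins :: "nat \<Rightarrow> 'a \<Rightarrow> 'a \<Rightarrow> 'a \<Rightarrow> 'a \<Rightarrow> bool" where
  "wins 0 p q s r \<longleftrightarrow> r \<in> {p, q, s}"
| "wins (Suc k) p q s r \<longleftrightarrow> r \<in> {p, q, s} \<or>
     (\<exists>p' q' s'. mv p p' \<and> mv q q' \<and> mv s s' \<and>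
        (r \<in> {p', q', s'} \<or> (\<forall>r'. mv r r' \<longrightarrow> wins k p' q' s' r')))"

lemma wins_here: "r \<in> {p, q, s} \<Longrightarrow> wins k p q s r"
  by (cases k) auto

lemma wins_swap: "wins k p q s r \<Longrightarrow> wins k q p s r"
proof (induction k arbitrary: p q s r)
  case (Suc k)
  show ?case
  proof (cases "r \<in> {p, q, s}")
    case False
    then obtain p' q' s' where m: "mv p p'" "mv q q'" "mv s s'"
      "r \<in> {p', q', s'} \<or> (\<forall>r'. mv r r' \<longrightarrow> wins k p' q' s' r')"
      using Suc.prems by auto
    have "r \<in> {q', p', s'} \<or> (\<forall>r'. mv r r' \<longrightarrow> wins k q' p' s' r')" using m(4) Suc.IH by blast
    then have "\<exists>p'' q'' s''. mv q p'' \<and> mv p q'' \<and> mv s s'' \<and>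
        (r \<in> {p'', q'', s''} \<or> (\<forall>r'. mv r r' \<longrightarrow> wins k p'' q'' s'' r'))" using m(1-3) by blast
    then show ?thesis by simp
  qed (auto intro: wins_here)
qed auto

lemma wins_adjacent:
  assumes "p \<in> V" "q \<in> V" "s \<in> V" "1 \<le> k" "r = p \<or> r = q \<or> E p r \<or> E q r \<or> E s r"
  shows "wins k p q s r"
proof (cases "r \<in> {p, q, s}")
  case False
  then have e: "E p r \<or> E q r \<or> E s r" using assms by auto
  obtain k' where k: "k = Suc k'" using assms by (cases k) auto
  have "\<exists>p' q' s'. mv p p' \<and> mv q q' \<and> mv s s' \<and> r \<in> {p', q', s'}"
    using e assms(1-3) unfolding mv_def by blast
  then show ?thesis unfolding k wins.simps by blast
qed (rule wins_here)

section \<open>Territories and their shrinking in one round\<close>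

definition territory :: "'a set \<Rightarrow> 'a set \<Rightarrow> bool" where
  "territory C D \<longleftrightarrow> separated C D \<and> C \<subseteq> V \<and> D \<subseteq> V \<and> (\<forall>q\<in>nbrs C. linked q D) \<and> nbrs C \<noteq> {}"

text \<open>\<open>C'\<close> is the robber's component after deletion of all vertices of
  \<open>C\<close> with a neighbour outside, and the old boundary joins \<open>D\<close>. The new
  boundary consists of deleted vertices, and these see the old boundary.\<close>

lemma territory_shrink:
  assumes T: "territory C D" and r: "r \<in> C" "r \<notin> seen (nbrs C) C"
  obtains C' where "territory C' (D \<union> nbrs C)" "r \<in> C'" "C' \<subseteq> C - seen (nbrs C) C"
    "nbrs C' \<subseteq> seen (nbrs C) C"
proof -
  define R where "R = seen (nbrs C) C"
  define C' where "C' = component (C - R) r"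
  have sep: "separated C D" and V: "C \<subseteq> V" "D \<subseteq> V" and Q: "\<And>q. q \<in> nbrs C \<Longrightarrow> linked q D"
    and ne: "nbrs C \<noteq> {}" using T by (auto simp: territory_def)
  have rS: "r \<in> C - R" using r by (simp add: R_def)
  have sub: "C' \<subseteq> C - R" unfolding C'_def by (rule component_subset[OF rS])
  have rC': "r \<in> C'" unfolding C'_def by (rule component_self)
  have nR: "\<not> E c q" if "c \<in> C'" "q \<in> nbrs C" for c q
    using that sub sym by (auto simp: R_def seen_def)
  have nb: "nbrs C' \<subseteq> R"
  proof
    fix q assume "q \<in> nbrs C'"
    then obtain c where c: "q \<notin> C'" "c \<in> C'" "E q c" by (auto simp: nbrs_def linked_def)
    have cq: "E c q" using c(3) by (rule sym)
    have "q \<in> C"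
    proof (rule ccontr)
      assume "q \<notin> C"
      then have "q \<in> nbrs C" using c sub by (auto simp: nbrs_def linked_def)
      then show False using nR c(2) cq by blast
    qed
    then show "q \<in> R" using component_closed[OF rS, of c q] c cq by (auto simp: C'_def)
  qed
  have RC: "R \<subseteq> C" "\<And>q. q \<in> R \<Longrightarrow> \<exists>d\<in>nbrs C. E q d" using sym by (auto simp: R_def seen_def)
  have disj: "C \<inter> (D \<union> nbrs C) = {}" using sep by (auto simp: separated_def nbrs_def linked_def)
  have "separated C' (D \<union> nbrs C)"
    unfolding separated_def
  proof (intro conjI ballI)
    show "conn C'" unfolding C'_def by (rule conn_component[OF rS])
    show "conn (D \<union> nbrs C)"
      using sep Q by (intro conn_Un) (auto simp: separated_def linked_def)
    show "C' \<inter> (D \<union> nbrs C) = {}" using disj sub by blast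
    show "\<not> E c d" if "c \<in> C'" "d \<in> D \<union> nbrs C" for c d
      using that nR sub sep unfolding separated_def by blast
  qed
  moreover have "linked q (D \<union> nbrs C)" if "q \<in> nbrs C'" for q
    using that nb RC disj unfolding linked_def by blast
  \<comment> \<open>Some vertex of the connected set \<open>C\<close> has been deleted, so an edge
    inside \<open>C\<close> leaves \<open>C'\<close>.\<close>
  moreover have "nbrs C' \<noteq> {}"
  proof -
    obtain q c where "q \<in> nbrs C" "c \<in> C" "E q c" using ne by (auto simp: nbrs_def linked_def)
    then have c: "c \<in> C" "c \<notin> C'" using sub by (auto simp: R_def seen_def)
    have "conn C" using sep by (simp add: separated_def)
    from conn_crossing[OF this r(1) c(1) rC' c(2)] obtain a b where "E a b" "a \<in> C'" "b \<notin> C'" by blast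
    then have "b \<in> nbrs C'" using sym[of a b] by (auto simp: nbrs_def linked_def)
    then show ?thesis by blast
  qed
  ultimately have "territory C' (D \<union> nbrs C)"
    unfolding territory_def using V sub nbrs_V by blast
  then show ?thesis using that rC' sub nb by (simp add: R_def)
qed

text \<open>A generic round in which the third cop waits. If the robber steps out of
  \<open>C\<close>, he is caught by \<open>N\<close>; if he ends next to the boundary, by the cover;
  the rest is left to \<open>next_round\<close>.\<close>

lemma wins_advance:
  assumes T: "territory C D" and r: "r \<in> C"
    and xy: "mv p x" "mv q y" "s \<in> V" "covers C x y"
    and N: "\<And>m. m \<in> nbrs C \<Longrightarrow> m = x \<or> m = y \<or> E x m \<or> E y m \<or> E s m"
    and k: "1 \<le> k"
    and next_round: "\<And>C' r'. territory C' (D \<union> nbrs C) \<Longrightarrow> r' \<in> C' \<Longrightarrow>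
      C' \<subseteq> C - seen (nbrs C) C \<Longrightarrow> nbrs C' \<subseteq> seen (nbrs C) C \<Longrightarrow> wins k x y s r'"
  shows "wins (Suc k) p q s r"
proof -
  have "wins k x y s r'" if r': "mv r r'" for r'
  proof -
    have V: "x \<in> V" "y \<in> V" using xy mv_V by auto
    have adj: "wins k x y s r'" if "r' = x \<or> r' = y \<or> E x r' \<or> E y r' \<or> E s r'"
      by (rule wins_adjacent[OF V xy(3) k that])
    have "r' \<in> C \<or> r' \<in> nbrs C" using r' r sym by (auto simp: mv_def nbrs_def linked_def)
    then consider "r' \<in> nbrs C" | "r' \<in> seen (nbrs C) C" | "r' \<in> C" "r' \<notin> seen (nbrs C) C" by blast
    then show ?thesis
    proof cases
      case 1
      then show ?thesis using N adj by blast
    next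
      case 2
      then show ?thesis using xy(4) adj by (auto simp: covers_def)
    next
      case 3
      then show ?thesis using territory_shrink[OF T] next_round by metis
    qed
  qed
  moreover have "mv s s" using xy by (simp add: mv_def)
  ultimately show ?thesis unfolding wins.simps using xy(1,2) by blast
qed

text \<open>The path from \<open>x\<close> to \<open>y\<close> starts outside \<open>C'\<close>. If
  it entered \<open>C'\<close>, it would do so from a vertex of \<open>nbrs C'\<close>, which sees
  \<open>y\<close> and hence is already the last on the path. So the path is lost to the robber and
  pays for its own length.\<close>

lemma path_eliminated:
  assumes C: "C \<subseteq> V" "C' \<subseteq> C - R" "nbrs C' \<subseteq> C" "nbrs C' \<noteq> {}"
    and y: "\<And>m. m \<in> nbrs C' \<Longrightarrow> E y m"
    and z: "cpath C x zs y" "hd zs \<in> R"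
  shows "card C' + of_bool (2 \<le> card (nbrs C')) + length zs \<le> card C"
proof -
  have zs: "zs \<noteq> []" "set zs \<subseteq> C" "ipath zs" "\<forall>z\<in>set zs. E y z \<longleftrightarrow> z = last zs"
    using z by (auto simp: cpath_def)
  have dist: "distinct zs" using zs(3) by (rule ipath_distinct)
  have disj: "set zs \<inter> C' = {}"
  proof (rule ccontr)
    assume "set zs \<inter> C' \<noteq> {}"
    then obtain us v vs where sp: "zs = us @ v # vs" "v \<in> C'" "\<forall>u\<in>set us. u \<notin> C'"
      using split_list_first_prop[of zs "\<lambda>v. v \<in> C'"] by blast
    have "us \<noteq> []" using z(2) sp(1,2) C(2) by (cases us) auto
    then have u: "last us \<in> set us" by simp
    have "E (last us) v" using zs(3) u unfolding sp(1) ipath_append by simp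
    then have "last us \<in> nbrs C'" using sp u by (auto simp: nbrs_def linked_def)
    then have "E y (last us)" by (rule y)
    then have "last us = last zs" using zs(4) sp u by auto
    moreover have "last zs \<in> set (v # vs)" using sp by simp
    ultimately show False using dist sp(1) u by auto
  qed
  have fin: "finite C" using C(1) finite_V finite_subset by blast
  have finQ: "finite (nbrs C')" by (rule finite_nbrs)
  have QC': "nbrs C' \<inter> C' = {}" by (auto simp: nbrs_def linked_def)
  \<comment> \<open>At most one boundary vertex is counted with the path; a second one yields the
    extra summand.\<close>
  have "set zs \<inter> nbrs C' \<subseteq> {last zs}" using zs(4) y by auto
  then have "card (nbrs C') \<le> card (nbrs C' - set zs) + 1"
  proof -
    assume sub: "set zs \<inter> nbrs C' \<subseteq> {last zs}"
    have "nbrs C' \<subseteq> insert (last zs) (nbrs C' - set zs)" using sub by auto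
    then have "card (nbrs C') \<le> card (insert (last zs) (nbrs C' - set zs))"
      using finQ by (intro card_mono) auto
    also have "\<dots> \<le> card (nbrs C' - set zs) + 1" using finQ by (simp add: card_insert_if)
    finally show ?thesis .
  qed
  moreover have "card (C' \<union> (set zs \<union> (nbrs C' - set zs))) = card C' + (card (set zs) + card (nbrs C' - set zs))"
    using disj QC' fin finQ C(2) finite_subset[of C' C]
    by (subst card_Un_disjoint; (subst card_Un_disjoint)?) auto
  moreover have "card (C' \<union> (set zs \<union> (nbrs C' - set zs))) \<le> card C"
    using fin zs(2) C by (intro card_mono) auto
  moreover have "card (set zs) = length zs" using dist by (rule distinct_card)
  ultimately show ?thesis by (auto simp: of_bool_def)
qed

text \<open>Here \<open>d\<close> bounds the distance of the helping cop \<open>q\<close>. The summand for two or more neighbours of \<open>C\<close>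
  and the constant \<open>3\<close> below are the reserves from which the next detour of a helper is paid.\<close>

definition held_by_one :: "nat \<Rightarrow> 'a \<Rightarrow> 'a \<Rightarrow> 'a \<Rightarrow> 'a \<Rightarrow> bool" where
  "held_by_one k b q s r \<longleftrightarrow> (\<exists>C D d. territory C D \<and> r \<in> C \<and> b \<in> D \<and> q \<in> V \<and> s \<in> V \<and> near d q b \<and>
     (\<forall>m\<in>nbrs C. E b m) \<and> (s = b \<or> (\<forall>u\<in>nbrs C. \<forall>v\<in>nbrs C. u \<noteq> v \<longrightarrow> E u v)) \<and>
     card C + of_bool (2 \<le> card (nbrs C)) + d + 1 \<le> k)"

definition held_by_two :: "nat \<Rightarrow> 'a \<Rightarrow> 'a \<Rightarrow> 'a \<Rightarrow> 'a \<Rightarrow> bool" where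
  "held_by_two k a b s r \<longleftrightarrow> (\<exists>C D. territory C D \<and> r \<in> C \<and> a \<in> D \<and> b \<in> D \<and> s \<in> V \<and>
     (\<forall>m\<in>nbrs C. E a m \<or> E b m) \<and> (\<exists>m\<in>nbrs C. \<not> E a m) \<and> (\<exists>m\<in>nbrs C. \<not> E b m) \<and>
     simplicial_to a (nbrs C) \<and> simplicial_to b (nbrs C) \<and> card C + 3 \<le> k)"

text \<open>The new boundary lies inside the old territory, which supplies both the clique property
  and the disjoint count.\<close>

lemma advance_facts:
  assumes T: "territory C D" and C': "C' \<subseteq> C - seen (nbrs C) C" "nbrs C' \<subseteq> seen (nbrs C) C"
    and x: "x \<in> nbrs C"
  shows "simplicial_to x (nbrs C')" "x \<in> D \<union> nbrs C" "x \<in> V"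
    and "card C' + card (nbrs C') \<le> card C"
proof -
  have sep: "separated C D" and l: "linked x D" and V: "C \<subseteq> V" using T x by (auto simp: territory_def)
  have sub: "nbrs C' \<subseteq> C" using C' by (auto simp: seen_def)
  have "simplicial_to x C" by (rule separated_simplicial[OF sep l])
  then show "simplicial_to x (nbrs C')" using sub unfolding simplicial_to_def by blast
  show "x \<in> D \<union> nbrs C" using x by simp
  show "x \<in> V" using x nbrs_V by blast
  have fin: "finite C" using V finite_V finite_subset by blast
  have "card (C' \<union> nbrs C') = card C' + card (nbrs C')"
    using C' fin finite_subset[of C' C] finite_nbrs by (intro card_Un_disjoint) auto
  then show "card C' + card (nbrs C') \<le> card C"
    using C' sub fin card_mono[of C "C' \<union> nbrs C'"] by auto
qed

lemma clique_simplicial: "simplicial_to x Q \<Longrightarrow> \<forall>m\<in>Q. E x m \<Longrightarrow> \<forall>u\<in>Q. \<forall>v\<in>Q. u \<noteq> v \<longrightarrow> E u v"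
  unfolding simplicial_to_def by blast

text \<open>Two cops on \<open>b\<close> move to a single covering vertex if there is one, and
  otherwise fork to \<open>x\<close> and \<open>y\<close>. In the second case the boundary has two
  vertices, and the reserve in the budget pays for reuniting the cops.\<close>

lemma fork_step:
  assumes IH1: "\<And>b q s r. held_by_one k b q s r \<Longrightarrow> wins k b q s r"
    and IH2: "\<And>a b s r. held_by_two k a b s r \<Longrightarrow> wins k a b s r"
    and T: "territory C D" and r: "r \<in> C" and b: "b \<in> D" "s \<in> V" "\<forall>m\<in>nbrs C. E b m"
    and cl: "s = b \<or> (\<forall>u\<in>nbrs C. \<forall>v\<in>nbrs C. u \<noteq> v \<longrightarrow> E u v)"
    and k: "card C + of_bool (2 \<le> card (nbrs C)) \<le> k"
  shows "wins (Suc k) b b s r"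
proof -
  let ?R = "seen (nbrs C) C"
  have sep: "separated C D" and V: "C \<subseteq> V" "D \<subseteq> V" and Q: "\<And>q. q \<in> nbrs C \<Longrightarrow> linked q D"
    and ne: "nbrs C \<noteq> {}" using T by (auto simp: territory_def)
  have fin: "finite C" using V finite_V finite_subset by blast
  have k1: "1 \<le> k" using k r fin card_gt_0_iff[of C] by auto
  have mvb: "mv b x" if "x \<in> nbrs C" for x using b that V by (auto simp: mv_def)
  \<comment> \<open>A robber on the old boundary is caught from \<open>b\<close> by the third cop,
    or from \<open>x\<close> if the boundary is a clique.\<close>
  have N: "m = x \<or> E x m \<or> E s m" if "x \<in> nbrs C" "m \<in> nbrs C" for x m
    using cl
  proof
    assume "s = b"
    then show ?thesis using b(3) that(2) by simp
  qed (use that in auto)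
  show ?thesis
  proof (cases "\<exists>x\<in>nbrs C. covers C x x")
    case True
    then obtain x where x: "x \<in> nbrs C" "covers C x x" by blast
    show ?thesis
    proof (rule wins_advance[OF T r mvb[OF x(1)] mvb[OF x(1)] b(2) x(2) _ k1])
      fix C' r' assume C': "territory C' (D \<union> nbrs C)" "r' \<in> C'" "C' \<subseteq> C - ?R" "nbrs C' \<subseteq> ?R"
      note f = advance_facts[OF T C'(3,4) x(1)]
      have xm: "\<forall>m\<in>nbrs C'. E x m" using C'(4) x(2) by (auto simp: covers_def)
      have "nbrs C' \<noteq> {}" using C'(1) by (simp add: territory_def)
      then have "1 \<le> card (nbrs C')" using finite_nbrs card_gt_0_iff[of "nbrs C'"] by auto
      then have "card C' + of_bool (2 \<le> card (nbrs C')) + 0 + 1 \<le> k" using f(4) k by (auto simp: of_bool_def)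
      then have "held_by_one k x x s r'"
        unfolding held_by_one_def
        using C'(1,2) f(2,3) b(2) xm clique_simplicial[OF f(1) xm] near.simps(1) by blast
      then show "wins k x x s r'" by (rule IH1)
    qed (use N[OF x(1)] in blast)
  next
    case False
    obtain x y where xy: "x \<in> nbrs C" "y \<in> nbrs C" "covers C x y"
      using two_cover[OF sep Q finite_nbrs ne] by blast
    obtain c c' where c: "c \<in> ?R" "\<not> E x c" "c' \<in> ?R" "\<not> E y c'"
      using False xy unfolding covers_def by blast
    then have "x \<noteq> y" using xy(3) by (auto simp: covers_def)
    then have "2 \<le> card (nbrs C)"
      using card_mono[OF finite_nbrs, of "{x, y}" C] xy by auto
    then have k2: "card C + 1 \<le> k" using k by simp
    have cc: "c \<noteq> c'" "c \<in> C" "c' \<in> C" using c xy(3) by (auto simp: covers_def seen_def)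
    \<comment> \<open>After the fork the cops are joined by a walk of length 2 through
      \<open>b\<close>.\<close>
    have near: "near 2 y x" "near 2 x y"
      using b(3) xy(1,2) sym unfolding numeral_2_eq_2 near.simps by blast+
    show ?thesis
    proof (rule wins_advance[OF T r mvb[OF xy(1)] mvb[OF xy(2)] b(2) xy(3) _ k1])
      fix C' r' assume C': "territory C' (D \<union> nbrs C)" "r' \<in> C'" "C' \<subseteq> C - ?R" "nbrs C' \<subseteq> ?R"
      note fx = advance_facts[OF T C'(3,4) xy(1)] and fy = advance_facts[OF T C'(3,4) xy(2)]
      have RC: "?R \<subseteq> C" by (auto simp: seen_def)
      have finC': "finite C'" using C'(3) fin finite_subset by blast
      have "nbrs C' \<noteq> {}" using C'(1) by (simp add: territory_def)
      then have Q1: "1 \<le> card (nbrs C')" using finite_nbrs card_gt_0_iff[of "nbrs C'"] by auto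
      \<comment> \<open>Applied to \<open>c\<close> or \<open>c'\<close>: a vertex missed by the cop
        who sees all of the new boundary is neither there nor in \<open>C'\<close>, and so saves one
        more round.\<close>
      have one: "card C' + card (nbrs C') + 1 \<le> card C" if "e \<in> ?R" "e \<notin> nbrs C'" for e
      proof -
        have "card (insert e (C' \<union> nbrs C')) = Suc (card (C' \<union> nbrs C'))"
          using that C'(3) finC' finite_nbrs by (intro card_insert_disjoint) auto
        also have "card (C' \<union> nbrs C') = card C' + card (nbrs C')"
          using C'(3,4) finC' finite_nbrs by (intro card_Un_disjoint) auto
        finally show ?thesis
          using card_mono[OF fin, of "insert e (C' \<union> nbrs C')"] that C'(3,4) RC by auto
      qed
      show "wins k x y s r'"
      proof (cases "\<forall>m\<in>nbrs C'. E x m")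
        case xm: True
        have "card C' + of_bool (2 \<le> card (nbrs C')) + 2 + 1 \<le> k"
          using one[of c] c xm k2 Q1 by (auto simp: of_bool_def)
        then have "held_by_one k x y s r'"
          unfolding held_by_one_def
          using C'(1,2) fx(2) fy(3) b(2) xm clique_simplicial[OF fx(1) xm] near(1) by blast
        then show ?thesis by (rule IH1)
      next
        case nx: False
        show ?thesis
        proof (cases "\<forall>m\<in>nbrs C'. E y m")
          case ym: True
          have "card C' + of_bool (2 \<le> card (nbrs C')) + 2 + 1 \<le> k"
            using one[of c'] c ym k2 Q1 by (auto simp: of_bool_def)
          then have "held_by_one k y x s r'"
            unfolding held_by_one_def
            using C'(1,2) fy(2) fx(3) b(2) ym clique_simplicial[OF fy(1) ym] near(2) by blast
          then show ?thesis using IH1 wins_swap by blast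
        next
          case ny: False
          have "card (C' \<union> {c, c'}) = card C' + card {c, c'}"
            using C'(3) c finC' by (intro card_Un_disjoint) auto
          then have "card C' + 2 \<le> card C"
            using card_mono[OF fin, of "C' \<union> {c, c'}"] C'(3) cc by auto
          then have "card C' + 3 \<le> k" using k2 by simp
          moreover have "\<forall>m\<in>nbrs C'. E x m \<or> E y m" using C'(4) xy(3) by (auto simp: covers_def)
          ultimately have "held_by_two k x y s r'"
            unfolding held_by_two_def using C'(1,2) fx(1,2) fy(1,2) b(2) nx ny by blast
          then show ?thesis by (rule IH2)
        qed
      qed
    qed (use N[OF xy(1)] in blast)
  qed
qed

text \<open>Both cops advance to a matched cover. If one of them then holds the whole new boundary,
  the other becomes his helper, and the induced path between them through the old territory pays for
  the walk; otherwise the pincer continues on a smaller territory.\<close>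

lemma pincer_step:
  assumes IH1: "\<And>b q s r. held_by_one k b q s r \<Longrightarrow> wins k b q s r"
    and IH2: "\<And>a b s r. held_by_two k a b s r \<Longrightarrow> wins k a b s r"
    and H: "held_by_two (Suc k) a b s r"
  shows "wins (Suc k) a b s r"
proof -
  obtain C D where T: "territory C D" and r: "r \<in> C" and ab: "a \<in> D" "b \<in> D" "s \<in> V"
    and m: "\<And>m. m \<in> nbrs C \<Longrightarrow> E a m \<or> E b m"
    and w: "\<exists>m\<in>nbrs C. \<not> E a m" "\<exists>m\<in>nbrs C. \<not> E b m"
    and cl: "simplicial_to a (nbrs C)" "simplicial_to b (nbrs C)" and k: "card C + 2 \<le> k"
    using H unfolding held_by_two_def by auto
  let ?R = "seen (nbrs C) C"
  have sep: "separated C D" and V: "C \<subseteq> V" "D \<subseteq> V" and Q: "\<And>q. q \<in> nbrs C \<Longrightarrow> linked q D"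
    using T by (auto simp: territory_def)
  have fin: "finite C" using V finite_V finite_subset by blast
  have k1: "1 \<le> k" using k by simp
  obtain w1 w2 where w12: "w1 \<in> nbrs C" "\<not> E a w1" "w2 \<in> nbrs C" "\<not> E b w2" using w by blast
  obtain x y where xy: "x \<in> nbrs C" "y \<in> nbrs C" "E a x" "E b y" "covers C x y"
    by (rule matched_cover[OF sep Q finite_nbrs ab(1,2) m simplicialD[OF cl(1)] simplicialD[OF cl(2)] w12])
  have mv: "mv a x" "mv b y" using xy ab V by (auto simp: mv_def)
  \<comment> \<open>The neighbours of \<open>a\<close> on the boundary form a clique containing
    \<open>x\<close>, those of \<open>b\<close> one containing \<open>y\<close>.\<close>
  have N: "n = x \<or> n = y \<or> E x n \<or> E y n \<or> E s n" if "n \<in> nbrs C" for n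
    using m[OF that] simplicialD[OF cl(1) xy(1) that xy(3)] simplicialD[OF cl(2) xy(2) that xy(4)] by blast
  have lC: "linked x C" "linked y C" using xy by (auto simp: nbrs_def)
  have conn: "conn C" using sep by (simp add: separated_def)
  show ?thesis
  proof (rule wins_advance[OF T r mv ab(3) xy(5) N k1])
    fix C' r' assume C': "territory C' (D \<union> nbrs C)" "r' \<in> C'" "C' \<subseteq> C - ?R" "nbrs C' \<subseteq> ?R"
    note fx = advance_facts[OF T C'(3,4) xy(1)] and fy = advance_facts[OF T C'(3,4) xy(2)]
    have ne: "nbrs C' \<noteq> {}" using C'(1) by (simp add: territory_def)
    have sub: "nbrs C' \<subseteq> C" using C'(4) by (auto simp: seen_def)
    have hd: "hd zs \<in> ?R" if "cpath C u zs v" "u \<in> nbrs C" for u zs v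
    proof -
      have "hd zs \<in> C" "E u (hd zs)" using that(1) hd_in_set[of zs] by (auto simp: cpath_def)
      then show ?thesis using that(2) by (auto simp: seen_def)
    qed
    show "wins k x y s r'"
    proof (cases "\<forall>m\<in>nbrs C'. E y m")
      case ym: True
      obtain zs where zs: "cpath C x zs y" by (rule linked_cpath[OF conn lC])
      have "card C' + of_bool (2 \<le> card (nbrs C')) + length zs \<le> card C"
        using path_eliminated[OF V(1) C'(3) sub ne _ zs hd[OF zs xy(1)]] ym by blast
      then have "card C' + of_bool (2 \<le> card (nbrs C')) + Suc (length zs) + 1 \<le> k" using k by simp
      then have "held_by_one k y x s r'"
        unfolding held_by_one_def
        using C'(1,2) fy(2) fx(3) ab(3) ym clique_simplicial[OF fy(1) ym] near_cpath[OF zs linkedD[OF lC(1)]]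
        by blast
      then show ?thesis using IH1 wins_swap by blast
    next
      case ny: False
      show ?thesis
      proof (cases "\<forall>m\<in>nbrs C'. E x m")
        case xm: True
        obtain zs where zs: "cpath C y zs x" by (rule linked_cpath[OF conn lC(2,1)])
        have "card C' + of_bool (2 \<le> card (nbrs C')) + length zs \<le> card C"
          using path_eliminated[OF V(1) C'(3) sub ne _ zs hd[OF zs xy(2)]] xm by blast
        then have "card C' + of_bool (2 \<le> card (nbrs C')) + Suc (length zs) + 1 \<le> k" using k by simp
        then have "held_by_one k x y s r'"
          unfolding held_by_one_def
          using C'(1,2) fx(2) fy(3) ab(3) xm clique_simplicial[OF fx(1) xm] near_cpath[OF zs linkedD[OF lC(2)]]
          by blast
        then show ?thesis by (rule IH1)
      next
        case nx: False
        have "0 < card (nbrs C')" using ne finite_nbrs card_gt_0_iff by blast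
        then have "card C' + 3 \<le> k" using fx(4) k by simp
        moreover have "\<forall>m\<in>nbrs C'. E x m \<or> E y m" using C'(4) xy(5) by (auto simp: covers_def)
        ultimately have "held_by_two k x y s r'"
          unfolding held_by_two_def using C'(1,2) fx(1,2) fy(1,2) ab(3) nx ny by blast
        then show ?thesis by (rule IH2)
      qed
    qed
  qed
qed

text \<open>While the helper \<open>q\<close> walks, the cop on \<open>b\<close> waits and sees
  every exit, so the territory is unchanged and each round lowers \<open>d\<close> by one. Once
  \<open>q\<close> has arrived, \<open>fork_step\<close> takes over.\<close>

lemma held_wins:
  "(held_by_one k b q s r \<longrightarrow> wins k b q s r) \<and> (held_by_two k b q s r \<longrightarrow> wins k b q s r)"
proof (induction k arbitrary: b q s r)
  case 0
  then show ?case by (auto simp: held_by_one_def held_by_two_def)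
next
  case (Suc k)
  have IH1: "held_by_one k b q s r \<Longrightarrow> wins k b q s r" for b q s r using Suc by blast
  have IH2: "held_by_two k b q s r \<Longrightarrow> wins k b q s r" for b q s r using Suc by blast
  have "wins (Suc k) b q s r" if H: "held_by_one (Suc k) b q s r"
  proof -
    obtain C D d where T: "territory C D" and r: "r \<in> C" and b: "b \<in> D" "q \<in> V" "s \<in> V" "near d q b"
      and m: "\<forall>m\<in>nbrs C. E b m"
      and cl: "s = b \<or> (\<forall>u\<in>nbrs C. \<forall>v\<in>nbrs C. u \<noteq> v \<longrightarrow> E u v)"
      and k: "card C + of_bool (2 \<le> card (nbrs C)) + d \<le> k"
      using H unfolding held_by_one_def by auto
    show ?thesis
    proof (cases "q = b")
      case True
      have "card C + of_bool (2 \<le> card (nbrs C)) \<le> k" using k by simp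
      from fork_step[OF IH1 IH2 T r b(1,3) m cl this] show ?thesis using True by simp
    next
      case False
      then obtain d' w where d: "d = Suc d'" "E q w" "near d' w b" using b(4) by (cases d) auto
      have bV: "b \<in> V" "w \<in> V" using T b d E_V sym by (auto simp: territory_def)
      have "wins k b w s r'" if r': "mv r r'" for r'
      proof -
        have "r' \<in> C \<or> r' \<in> nbrs C" using r' r sym by (auto simp: mv_def nbrs_def linked_def)
        then show ?thesis
        proof
          assume "r' \<in> C"
          then have "held_by_one k b w s r'"
            unfolding held_by_one_def using T b(1,3) bV(2) d(3) m cl k d(1)
            by (intro exI[of _ C] exI[of _ D] exI[of _ d']) auto
          then show ?thesis by (rule IH1)
        next
          assume "r' \<in> nbrs C"
          then have "E b r'" using m by blast
          then show ?thesis using wins_adjacent[OF bV b(3)] k d(1) by simp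
        qed
      qed
      moreover have "mv b b" "mv q w" "mv s s" using bV b d by (auto simp: mv_def)
      ultimately show ?thesis unfolding wins.simps by blast
    qed
  qed
  moreover have "wins (Suc k) b q s r" if "held_by_two (Suc k) b q s r"
    using pincer_step[OF IH1 IH2 that] by blast
  ultimately show ?case by blast
qed

text \<open>The budget is \<open>card V - 1\<close> because placing the cops already takes one
  round. The third cop stays on \<open>u\<close>, whose neighbourhood may fail to be a
  clique.\<close>

lemma start_wins:
  assumes conn: "conn V" and u: "u \<in> V" and r: "r \<in> V"
  shows "wins (card V - 1) u u u r"
proof (cases "r = u")
  case True
  then show ?thesis by (intro wins_here) simp
next
  case ru: False
  have "card {u, r} \<le> card V" using u r finite_V by (intro card_mono) auto
  then have cV: "2 \<le> card V" using ru by simp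
  show ?thesis
  proof (cases "E u r")
    case True
    then show ?thesis using wins_adjacent[of u u u "card V - 1" r] u cV by simp
  next
    case False
    define S where "S = {v \<in> V. v \<noteq> u \<and> \<not> E u v}"
    define C where "C = component S r"
    have rS: "r \<in> S" using r ru False by (simp add: S_def)
    have CS: "C \<subseteq> S" unfolding C_def by (rule component_subset[OF rS])
    have rC: "r \<in> C" unfolding C_def by (rule component_self)
    have Cu: "\<not> E c u" "c \<noteq> u" if "c \<in> C" for c using that CS sym by (auto simp: S_def)
    have nb: "E u q" if q: "q \<in> nbrs C" for q
    proof -
      obtain c where c: "q \<notin> C" "c \<in> C" "E q c" using q by (auto simp: nbrs_def linked_def)
      have cq: "E c q" using c(3) by (rule sym)
      then have "q \<noteq> u" using Cu c by blast
      moreover have "q \<notin> S" using component_closed[OF rS _ _ cq] c by (auto simp: C_def)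
      ultimately show ?thesis using c E_V by (auto simp: S_def)
    qed
    have uC: "u \<notin> C" using Cu by blast
    have "separated C {u}"
      unfolding separated_def using conn_component[OF rS] conn_singleton Cu by (auto simp: C_def)
    moreover have "nbrs C \<noteq> {}"
    proof -
      from conn_crossing[OF conn r u rC uC] obtain a b where "E a b" "a \<in> C" "b \<notin> C" by blast
      then have "b \<in> nbrs C" using sym[of a b] by (auto simp: nbrs_def linked_def)
      then show ?thesis by blast
    qed
    moreover have "linked q {u}" if "q \<in> nbrs C" for q
      using nb[OF that] sym irrefl by (auto simp: linked_def)
    ultimately have T: "territory C {u}"
      unfolding territory_def using CS u by (auto simp: S_def)
    have fin: "finite C" using CS finite_V finite_subset[of C V] by (auto simp: S_def)
    have "card (C \<union> nbrs C) = card C + card (nbrs C)"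
      using fin finite_nbrs by (intro card_Un_disjoint) (auto simp: nbrs_def linked_def)
    moreover have "card (insert u (C \<union> nbrs C)) = Suc (card (C \<union> nbrs C))"
      using fin finite_nbrs uC nb irrefl by (intro card_insert_disjoint) auto
    moreover have "card (insert u (C \<union> nbrs C)) \<le> card V"
      using finite_V u CS nbrs_V by (intro card_mono) (auto simp: S_def)
    moreover have "0 < card (nbrs C)" using \<open>nbrs C \<noteq> {}\<close> finite_nbrs card_gt_0_iff by blast
    \<comment> \<open>\<open>u\<close>, \<open>C\<close> and \<open>nbrs C\<close> are disjoint; the
      boundary pays for one round, and for its reserve if it has two vertices.\<close>
    ultimately have "card C + of_bool (2 \<le> card (nbrs C)) + 0 + 1 \<le> card V - 1"
      by (auto simp: of_bool_def)
    then have "held_by_one (card V - 1) u u u r"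
      unfolding held_by_one_def using T rC u nb
      by (intro exI[of _ C] exI[of _ "{u}"] exI[of _ 0]) simp
    then show ?thesis using held_wins by blast
  qed
qed

section \<open>Extraction of a strategy from winning positions\<close>

text \<open>In \<open>good_move\<close> and \<open>reply\<close>, \<open>k\<close> is the number of rounds left after the move.\<close>

definition good_move :: "nat \<Rightarrow> 'a \<times> 'a \<times> 'a \<Rightarrow> 'a \<Rightarrow> 'a \<times> 'a \<times> 'a \<Rightarrow> bool" where
  "good_move k c r c' = (case (c, c') of ((p, q, s), (p', q', s')) \<Rightarrow>
     mv p p' \<and> mv q q' \<and> mv s s' \<and> (r \<in> {p', q', s'} \<or> (\<forall>r'. mv r r' \<longrightarrow> wins k p' q' s' r')))"

definition reply :: "nat \<Rightarrow> 'a \<times> 'a \<times> 'a \<Rightarrow> 'a \<Rightarrow> 'a \<times> 'a \<times> 'a" where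
  "reply k c r = (if \<exists>c'. good_move k c r c' then SOME c'. good_move k c r c' else c)"

text \<open>The history is passed in reverse, so that the robber's last vertex is its head.\<close>

primrec cops_at :: "'a \<Rightarrow> 'a list \<Rightarrow> 'a \<times> 'a \<times> 'a" where
  "cops_at u [] = (u, u, u)"
| "cops_at u (r # h) = reply (card V - 2 - length h) (cops_at u h) r"

fun nth3 :: "'a \<times> 'a \<times> 'a \<Rightarrow> nat \<Rightarrow> 'a" where
  "nth3 (p, q, s) i = (if i = 0 then p else if i = 1 then q else s)"

definition winning_strategy :: "'a \<Rightarrow> 'a list \<Rightarrow> nat \<Rightarrow> 'a" where
  "winning_strategy u h i = nth3 (cops_at u (rev h)) i"

definition wins3 :: "nat \<Rightarrow> 'a \<times> 'a \<times> 'a \<Rightarrow> 'a \<Rightarrow> bool" where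
  "wins3 k c r = (case c of (p, q, s) \<Rightarrow> wins k p q s r)"

lemma nth3_range: "r \<in> {p, q, s} \<longleftrightarrow> (\<exists>i<3. nth3 (p, q, s) i = r)"
proof -
  have "(\<exists>i<3. nth3 (p, q, s) i = r) \<longleftrightarrow> nth3 (p, q, s) 0 = r \<or> nth3 (p, q, s) 1 = r \<or> nth3 (p, q, s) 2 = r"
    by (simp add: numeral_3_eq_3 less_Suc_eq ex_disj_distrib numeral_2_eq_2 conj_disj_distribR)
  then show ?thesis by auto
qed

text \<open>This covers histories without a good move, where \<open>reply\<close> lets the cops
  stay; so legality holds against every play.\<close>

lemma reply_legal:
  assumes "\<And>i. nth3 c i \<in> V"
  shows "mv (nth3 c i) (nth3 (reply k c r) i)"
proof (cases "\<exists>c'. good_move k c r c'")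
  case True
  then have "good_move k c r (reply k c r)" unfolding reply_def by (auto intro: someI)
  then show ?thesis
    by (cases c; cases "reply k c r") (auto simp: good_move_def)
next
  case False
  then show ?thesis using assms by (simp add: reply_def mv_def)
qed

text \<open>A position may count as won merely because the robber is already caught, and then a good
  move is not guaranteed; hence the second assumption.\<close>

lemma reply_wins:
  assumes "wins3 (Suc k) c r" "\<not> (\<exists>i<3. nth3 c i = r)"
  shows "(\<exists>i<3. nth3 (reply k c r) i = r) \<or> (\<forall>r'. mv r r' \<longrightarrow> wins3 k (reply k c r) r')"
proof -
  obtain p q s where c: "c = (p, q, s)" by (cases c)
  have "r \<notin> {p, q, s}" using assms(2) nth3_range unfolding c by blast
  then obtain p' q' s' where "mv p p'" "mv q q'" "mv s s'"
    "r \<in> {p', q', s'} \<or> (\<forall>r'. mv r r' \<longrightarrow> wins k p' q' s' r')"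
    using assms(1) unfolding c wins3_def by auto
  then have "good_move k c r (p', q', s')" by (simp add: good_move_def c)
  then have "good_move k c r (reply k c r)" unfolding reply_def by (metis someI)
  moreover obtain p' q' s' where "reply k c r = (p', q', s')" by (cases "reply k c r")
  ultimately show ?thesis unfolding c good_move_def wins3_def using nth3_range by auto
qed

lemma cops_at_V: "u \<in> V \<Longrightarrow> nth3 (cops_at u h) i \<in> V"
proof (induction h arbitrary: i)
  case (Cons r h)
  then have "mv (nth3 (cops_at u h) i) (nth3 (cops_at u (r # h)) i)"
    unfolding cops_at.simps by (intro reply_legal) simp
  then show ?case by (rule mv_V)
qed simp

text \<open>The invariant of an uncaptured play: every round spent leaves a position that is won
  with one round less.\<close>

lemma cops_at_captures:
  assumes u: "u \<in> V" and win: "\<And>r. r \<in> V \<Longrightarrow> wins (card V - 1) u u u r"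
    and r: "r 0 \<in> V" "\<And>t. mv (r t) (r (Suc t))"
    and free: "\<And>t. t < card V \<Longrightarrow> \<not> (\<exists>i<3. nth3 (cops_at u (rev (map r [0..<t]))) i = r t) \<and>
      (0 < t \<longrightarrow> \<not> (\<exists>i<3. nth3 (cops_at u (rev (map r [0..<t]))) i = r (t - 1)))"
    and t: "t < card V"
  shows "wins3 (card V - 1 - t) (cops_at u (rev (map r [0..<t]))) (r t)"
  using t
proof (induction t)
  case 0
  then show ?case using win r(1) by (simp add: wins3_def)
next
  case (Suc t)
  let ?c = "cops_at u (rev (map r [0..<t]))"
  \<comment> \<open>The bound \<open>Suc t < card V\<close> keeps the truncated subtractions
    exact.\<close>
  have k: "card V - 1 - t = Suc (card V - 2 - t)" "card V - 1 - Suc t = card V - 2 - t"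
    using Suc.prems by auto
  have next_c: "cops_at u (rev (map r [0..<Suc t])) = reply (card V - 2 - t) ?c (r t)" by simp
  have "wins3 (Suc (card V - 2 - t)) ?c (r t)" using Suc k by simp
  moreover have "\<not> (\<exists>i<3. nth3 ?c i = r t)" using free[of t] Suc.prems by simp
  moreover have "\<not> (\<exists>i<3. nth3 (reply (card V - 2 - t) ?c (r t)) i = r t)"
    using free[of "Suc t"] Suc.prems unfolding next_c by simp
  ultimately have "wins3 (card V - 2 - t) (reply (card V - 2 - t) ?c (r t)) (r (Suc t))"
    using reply_wins r(2) by blast
  then show ?case unfolding next_c k .
qed

lemma no_escape:
  assumes conn: "conn V" and u: "u \<in> V" and r: "r 0 \<in> V" "\<And>t. mv (r t) (r (Suc t))"
  shows "\<exists>t<card V. \<exists>i<3. (0 < t \<and> winning_strategy u (map r [0..<t]) i = r (t - 1)) \<or>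
    winning_strategy u (map r [0..<t]) i = r t"
proof (rule ccontr)
  assume no: "\<not> ?thesis"
  have free: "\<not> (\<exists>i<3. nth3 (cops_at u (rev (map r [0..<t]))) i = r t) \<and>
      (0 < t \<longrightarrow> \<not> (\<exists>i<3. nth3 (cops_at u (rev (map r [0..<t]))) i = r (t - 1)))"
    if "t < card V" for t
    using no that unfolding winning_strategy_def by blast
  have "0 < card V" using u finite_V card_gt_0_iff by blast
  \<comment> \<open>At the last admissible index no further round remains, so winning there means a
    capture.\<close>
  then have last: "card V - 1 < card V" by simp
  let ?c = "cops_at u (rev (map r [0..<card V - 1]))"
  have "wins3 0 ?c (r (card V - 1))"
    using cops_at_captures[OF u start_wins[OF conn u] r free last] by simp
  then have "\<exists>i<3. nth3 ?c i = r (card V - 1)"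
    using nth3_range by (cases ?c) (auto simp: wins3_def)
  then show False using free[OF last] by blast
qed

end

section \<open>Transfer to digraphs\<close>

text \<open>The vertex set of a forbidden configuration is turned into the induced subgraph
  \<open>G \<restriction> S\<close>, to which the digraph definitions apply.\<close>

lemma (in graph) claw_even_hole_free_arena:
  assumes claw: "claw_free G" and hole: "even_hole_free G"
  shows "cops_arena (\<lambda>u v. (u, v) \<in> arcs_ends G) (verts G)"
proof -
  let ?E = "\<lambda>u v. (u, v) \<in> arcs_ends G"
  interpret simple_graph ?E
    by unfold_locales (auto intro: graph_symmetric dest: adj_not_same)
  have ind: "induced_subgraph (G \<restriction> S) G" "graph (G \<restriction> S)" if "S \<subseteq> verts G" for S
  proof -
    show i: "induced_subgraph (G \<restriction> S) G" using that by (rule induced_induce)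
    have "subgraph (G \<restriction> S) G" using i by (rule induced_imp_subgraph)
    show "graph (G \<restriction> S)"
      using digraph_subgraph[OF \<open>subgraph (G \<restriction> S) G\<close>] induced_graph_imp_symmetric[OF sym_arcs i]
      by (rule digraph.graphI)
  qed
  have ends: "arcs_ends (G \<restriction> S) = {(u, v). ?E u v \<and> u \<in> S \<and> v \<in> S}" for S
    by (auto simp: arcs_ends_conv)
  show ?thesis
  proof unfold_locales
    fix c x y z assume e: "?E c x" "?E c y" "?E c z" and d: "x \<noteq> y" "x \<noteq> z" "y \<noteq> z"
    show "?E x y \<or> ?E x z \<or> ?E y z"
    proof (rule ccontr)
      assume n: "\<not> ?thesis"
      define S where "S = {c, x, y, z}"
      have S: "S \<subseteq> verts G" using e adj_in_verts by (auto simp: S_def)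
      have cn: "c \<noteq> x" "c \<noteq> y" "c \<noteq> z" using e irrefl by auto
      have "arcs_ends (G \<restriction> S) = {c} \<times> {x, y, z} \<union> {x, y, z} \<times> {c}"
        unfolding ends S_def using e n irrefl sym by auto
      then have "complete_bipartite_digraph 1 3 (G \<restriction> S)"
        unfolding complete_bipartite_digraph_def
      proof (intro conjI exI)
        show "verts (G \<restriction> S) = {c} \<union> {x, y, z}" by (auto simp: S_def)
        show "{c} \<inter> {x, y, z} = {}" using cn by simp
        show "card {x, y, z} = 3" using d by simp
      qed (use ind(2)[OF S] in auto)
      then show False using claw ind(1)[OF S] unfolding claw_free_def by blast
    qed
  next
    fix zs v
    assume z: "ipath zs" "3 \<le> length zs" "v \<notin> set zs"
      "\<forall>z\<in>set zs. ?E v z \<longleftrightarrow> z = hd zs \<or> z = last zs"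
    show "even (length zs)"
    proof (rule ccontr)
      assume odd: "odd (length zs)"
      define S where "S = set (v # zs)"
      define k where "k = Suc (length zs)"
      \<comment> \<open>The cycle is numbered with \<open>v\<close> at position \<open>0\<close> and
        \<open>zs ! l\<close> at position \<open>Suc l\<close>.\<close>
      define c where "c i = (v # zs) ! i" for i
      have ne: "zs \<noteq> []" using z(2) by auto
      have adj: "?E (c i) (c j) \<longleftrightarrow> j = Suc i mod k \<or> i = Suc j mod k" if ij: "i < k" "j < k" for i j
      proof -
        have dist: "distinct zs" using z(1) by (rule ipath_distinct)
        have v0: "?E v (zs ! l) \<longleftrightarrow> l = 0 \<or> Suc l = length zs" if l: "l < length zs" for l
        proof -
          have "hd zs = zs ! 0" "last zs = zs ! (length zs - 1)" using ne by (auto simp: hd_conv_nth last_conv_nth)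
          moreover have "zs ! l = zs ! 0 \<longleftrightarrow> l = 0" "zs ! l = zs ! (length zs - 1) \<longleftrightarrow> l = length zs - 1"
            using nth_eq_iff_index_eq[OF dist l] ne by auto
          moreover have "?E v (zs ! l) \<longleftrightarrow> zs ! l = hd zs \<or> zs ! l = last zs" using z(4) l by simp
          ultimately show ?thesis using l by auto
        qed
        have m: "Suc l mod k = (if Suc l = k then 0 else Suc l)" if "l < k" for l using that by auto
        show ?thesis
          unfolding m[OF ij(1)] m[OF ij(2)]
        proof (cases i)
          case i: 0
          show "?E (c i) (c j) \<longleftrightarrow> j = (if Suc i = k then 0 else Suc i) \<or> i = (if Suc j = k then 0 else Suc j)"
          proof (cases j)
            case 0
            then show ?thesis using i irrefl[of v] ne by (simp add: c_def k_def)
          next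
            case (Suc j')
            then show ?thesis using i v0[of j'] ij ne by (simp add: c_def k_def)
          qed
        next
          case i: (Suc i')
          show "?E (c i) (c j) \<longleftrightarrow> j = (if Suc i = k then 0 else Suc i) \<or> i = (if Suc j = k then 0 else Suc j)"
          proof (cases j)
            case 0
            have "?E (zs ! i') v \<longleftrightarrow> i' = 0 \<or> Suc i' = length zs"
              using v0[of i'] adj_commute[of v] i ij by (simp add: k_def)
            then show ?thesis using 0 i ij ne by (auto simp: c_def k_def)
          next
            case (Suc j')
            have l: "i' < length zs" "j' < length zs" using i Suc ij by (auto simp: k_def)
            have e: "?E (c i) (c j) \<longleftrightarrow> j' = Suc i' \<or> i' = Suc j'"
              using ipath_nth_adj[OF z(1) l] i Suc by (simp add: c_def)
            show ?thesis unfolding e using l unfolding i Suc k_def by presburger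
          qed
        qed
      qed
      have dist: "distinct (v # zs)" using ipath_distinct[OF z(1)] z(3) by simp
      have img: "c ` {..<k} = S"
        unfolding c_def S_def k_def set_conv_nth length_Cons by blast
      have bij: "bij_betw c {..<k} S"
      proof (rule bij_betw_imageI[OF _ img])
        show "inj_on c {..<k}"
          using dist nth_eq_iff_index_eq[OF dist] unfolding inj_on_def c_def k_def by auto
      qed
      \<comment> \<open>Each vertex of the cycle is adjacent to its cyclic successor, and ends of
        arcs are vertices of \<open>G\<close>.\<close>
      have S: "S \<subseteq> verts G"
      proof
        fix s assume "s \<in> S"
        then obtain i where i: "i < k" "s = c i" using img by auto
        moreover have "Suc i mod k < k" using i by simp
        ultimately have "?E s (c (Suc i mod k))" using adj[of i "Suc i mod k"] by simp
        then show "s \<in> verts G" using adj_in_verts by blast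
      qed
      have "arcs_ends (G \<restriction> S) = (\<Union>i<k. {(c i, c (Suc i mod k)), (c (Suc i mod k), c i)})"
      proof (intro set_eqI iffI)
        fix e assume "e \<in> arcs_ends (G \<restriction> S)"
        then obtain a b where "e = (a, b)" "?E a b" "a \<in> S" "b \<in> S" unfolding ends by blast
        moreover then obtain i j where "i < k" "j < k" "a = c i" "b = c j" using img by auto
        ultimately show "e \<in> (\<Union>i<k. {(c i, c (Suc i mod k)), (c (Suc i mod k), c i)})"
          using adj[of i j] by auto
      next
        fix e assume "e \<in> (\<Union>i<k. {(c i, c (Suc i mod k)), (c (Suc i mod k), c i)})"
        then obtain i where i: "i < k" "e = (c i, c (Suc i mod k)) \<or> e = (c (Suc i mod k), c i)" by auto
        moreover have "Suc i mod k < k" using i by simp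
        ultimately have "?E (c i) (c (Suc i mod k))" "?E (c (Suc i mod k)) (c i)" "c i \<in> S" "c (Suc i mod k) \<in> S"
          using adj[of i "Suc i mod k"] adj[of "Suc i mod k" i] img by auto
        then show "e \<in> arcs_ends (G \<restriction> S)" unfolding ends using i by auto
      qed
      then have "cycle_graph k (G \<restriction> S)"
        unfolding cycle_graph_def using ind(2)[OF S] bij z(2) by (auto simp: k_def)
      then have "hole k (G \<restriction> S) G"
        unfolding hole_def using ind(1)[OF S] z(2) by (simp add: k_def)
      moreover have "even k" using odd by (simp add: k_def)
      ultimately show False using hole unfolding even_hole_free_def by blast
    qed
  qed (use adj_in_verts in auto)
qed

theorem theorem4p4:
  fixes G :: "('a, 'b) pre_digraph" and n :: nat
  assumes "graph G"
    and "Digraph_Component.connected G"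
    and "claw_free G"
    and "even_hole_free G"
    and "card (verts G) = n"
  shows "cops_capture_within G 3 n"
proof -
  interpret graph G by (rule assms(1))
  interpret cops_arena "\<lambda>u v. (u, v) \<in> arcs_ends G" "verts G"
    by (rule claw_even_hole_free_arena[OF assms(3,4)])
  \<comment> \<open>Symmetry of the arcs turns connectedness into directed reachability between any
    two vertices.\<close>
  have "strongly_connected G" 
    by (rule symmetric_connected_imp_strongly_connected[OF sym_arcs assms(2)])
  then have ne: "verts G \<noteq> {}" and reach: "\<And>u v. u \<in> verts G \<Longrightarrow> v \<in> verts G \<Longrightarrow> u \<rightarrow>\<^sup>*\<^bsub>G\<^esub> v"
    by (auto simp: strongly_connected_def)
  have conn: "conn (verts G)"
    unfolding conn_def
  proof (intro ballI)
    fix u v assume "u \<in> verts G" "v \<in> verts G"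
    then have "u \<rightarrow>\<^sup>*\<^bsub>G\<^esub> v" by (rule reach)
    then show "(\<lambda>a b. a \<in> verts G \<and> b \<in> verts G \<and> (a, b) \<in> arcs_ends G)\<^sup>*\<^sup>* u v"
    proof (induction rule: reachable_induct)
      case (step x y)
      then show ?case using adj_in_verts by (auto intro: rtranclp.rtrancl_into_rtrancl)
    qed simp
  qed
  obtain u where u: "u \<in> verts G" using ne by blast
  let ?\<sigma> = "winning_strategy u"
  have mv: "stay_or_move G v w \<longleftrightarrow> mv v w" for v w by (auto simp: stay_or_move_def mv_def)
  have "cop_strategy G 3 ?\<sigma>"
    unfolding cop_strategy_def cop_pos_def mv
  proof (intro conjI allI impI)
    show "?\<sigma> [] i \<in> verts G" for i using u by (simp add: winning_strategy_def)
    show "mv (?\<sigma> (map r [0..<t]) i) (?\<sigma> (map r [0..<Suc t]) i)" for r t i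
      using reply_legal[OF cops_at_V[OF u]] by (simp add: winning_strategy_def)
  qed
  moreover have "\<exists>t<n. captured_in_round_Suc 3 ?\<sigma> r t" if "robber_play G r" for r
    using no_escape[OF conn u, of r] that assms(5)
    unfolding captured_in_round_Suc_def cop_pos_def robber_play_def mv by blast
  ultimately show ?thesis unfolding cops_capture_within_def by blast
qed

end
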